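(* Let $\Omega=[\mathbb{X},\mathbb{L},\mathbb{U}_M]$ be a constellation with uniform input distribution. Then $\Omega$ is first-order optimal (FOO) for BICM if and only if there exists a real $m\times N$ matrix $\mathbb{V}$ (with rows $\boldsymbol{v}_0,\ldots,\boldsymbol{v}_{m-1}$) such that $$\mathbb{X}=\mathbb{Q}(\mathbb{L})\,\mathbb{V}.$$
   Context: Constellations. Fix integers $m,N\ge 1$ and let $M=2^m$. An input alphabet $\mathbb{X}$ is an $M\times N$ real matrix whose rows $\boldsymbol{x}_0,\ldots,\boldsymbol{x}_{M-1}\in\mathbb{R}^N$ (row vectors) are pairwise distinct. A binary labeling $\mathbb{L}$ of order $m$ is an $M\times m$ matrix whose rows $\boldsymbol{c}_i=[c_{i,0},\ldots,c_{i,m-1}]$, $i=0,\ldots,M-1$, are the $M$ distinct elements of $\{0,1\}^m$. $[\mathbb{X},\mathbb{L},\mathbb{U}_M]$ denotes the constellation in which the bits $C_0,\ldots,C_{m-1}$ are independent and uniform on $\{0,1\}$ and the transmitted symbol is $\boldsymbol{X}=\boldsymbol{x}_i$ when $[C_0,\ldots,C_{m-1}]=\boldsymbol{c}_i$ (so $\boldsymbol{X}$ is uniform on the $M$ symbols). Put $E_s=\mathbb{E}[\|\boldsymbol{X}\|^2]$. Modified labeling matrix. $\mathbb{Q}(\mathbb{L})$ is the $M\times m$ matrix with entries $q_{i,k}=-1$ if $c_{i,m-1-k}=1$ and $q_{i,k}=+1$ if $c_{i,m-1-k}=0$, for $i=0,\ldots,M-1$, $k=0,\ldots,m-1$. Channel.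 $\boldsymbol{Y}=\boldsymbol{H}\circ\boldsymbol{X}+\boldsymbol{Z}$, where $\circ$ is the element-wise product, $\boldsymbol{X},\boldsymbol{H},\boldsymbol{Z}$ are mutually independent, $\boldsymbol{Z}$ is Gaussian in $\mathbb{R}^N$ with independent zero-mean components of variance $N_0/2$, and $\boldsymbol{H}$ is a real random vector whose $N$ components (possibly dependent) all have the same distribution, that of a random variable $H$, with $0<\mathbb{E}[H^2]<\infty$. It is assumed that there is $\omega>0$ such that $\Pr\{\|\boldsymbol{H}\|^2>\Delta\}\le\exp(-\Delta^\omega)$ for all sufficiently large $\Delta>0$. $\boldsymbol{H}$ and $N_0$ are known at the receiver. Define $\mathsf{SNR}=\mathbb{E}[H^2]\,E_s/N_0$; the constellation and the law of $\boldsymbol{H}$ are fixed and $N_0$ varies over $(0,\infty)$, so $\mathsf{SNR}\to0$ means $N_0\to\infty$. BICM capacity (in bits). $\mathsf{I}^{\mathrm{BI}}_\Omega(\mathsf{SNR})=\sum_{k=0}^{m-1}\mathbb{E}\left[\log_2\frac{p_{\boldsymbol{Y}|C_k,\boldsymbol{H}}(\boldsymbol{Y})}{p_{\boldsymbol{Y}|\boldsymbol{H}}(\boldsymbol{Y})}\right]$. The coefficient $\alpha^{\mathrm{BI}}_\Omega$ is defined by $\mathsf{I}^{\mathrm{BI}}_\Omega(\mathsf{SNR})=\alpha^{\mathrm{BI}}_\Omega\,\mathsf{SNR}+O(\mathsf{SNR}^2)$ as $\mathsf{SNR}\to 0$. The constellation $\Omega$ is first-order optimal (FOO) for BICM if $\alpha^{\mathrm{BI}}_\Omega=\log_2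 e$. *)

theory Defs
  imports
    "HOL-Probability.Probability"
    "HOL-Real_Asymp.Real_Asymp"
    "Jordan_Normal_Form.Matrix"
begin

text \<open>
  Conventions. Symbols, labels and matrices are vectors and matrices of Jordan_Normal_Form.
  Random vectors in \<open>\<real>\<^sup>N\<close> (fading, noise, received vector) are elements of the
  product space \<open>Pi\<^sub>M {..<N} (\<lambda>_. borel)\<close>. A constellation \<open>[X, L, U\<^sub>M]\<close> is given by the pair
  \<open>X\<close>, \<open>L\<close>; its parameters are \<open>m = dim_col L\<close> and \<open>N = dim_col X\<close>. The fading is given by
  the law \<open>\<nu>\<close> of the vector \<open>H\<close> and by the common law \<open>\<eta>\<close> of its components.
\<close>

definition input_alphabet :: "nat \<Rightarrow> nat \<Rightarrow> real mat \<Rightarrow> bool" where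
  "input_alphabet m N X \<longleftrightarrow> X \<in> carrier_mat (2 ^ m) N \<and> distinct (rows X)"

definition binary_labeling :: "nat \<Rightarrow> nat mat \<Rightarrow> bool" where
  "binary_labeling m L \<longleftrightarrow> L \<in> carrier_mat (2 ^ m) m \<and>
     bij_betw (row L) {..<2 ^ m} {c \<in> carrier_vec m. \<forall>k<m. c $ k \<in> {0, 1}}"

definition modified_labeling :: "nat mat \<Rightarrow> real mat" where
  "modified_labeling L = mat (dim_row L) (dim_col L)
     (\<lambda>(i, k). if L $$ (i, dim_col L - 1 - k) = 1 then - 1 else 1)"

text \<open>Law of independent uniform bits \<open>C\<^sub>0, \<dots>, C\<^sub>m\<^sub>-\<^sub>1\<close>; the entries \<open>C\<^sub>k\<close> with \<open>k \<ge> m\<close> are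
  the dummy value \<open>0\<close>.\<close>

definition uniform_bits :: "nat \<Rightarrow> (nat \<Rightarrow> nat) pmf" where
  "uniform_bits m = Pi_pmf {..<m} 0 (\<lambda>_. pmf_of_set {0, 1})"

text \<open>The symbol \<open>x\<^sub>i\<close> for the unique \<open>i\<close> whose label \<open>c\<^sub>i\<close> is the given bit vector.\<close>

definition symbol :: "real mat \<Rightarrow> nat mat \<Rightarrow> (nat \<Rightarrow> nat) \<Rightarrow> real vec" where
  "symbol X L c = row X (inv_into {..<dim_row L} (row L) (vec (dim_col L) c))"

definition symbol_energy :: "real mat \<Rightarrow> nat mat \<Rightarrow> real" where
  "symbol_energy X L =
     measure_pmf.expectation (uniform_bits (dim_col L))
       (\<lambda>c. \<Sum>j<dim_col X. (symbol X L c $ j)\<^sup>2)"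

definition gaussian_noise :: "nat \<Rightarrow> real \<Rightarrow> (nat \<Rightarrow> real) measure" where
  "gaussian_noise N N0 =
     Pi\<^sub>M {..<N} (\<lambda>_. density lborel (\<lambda>z. ennreal (normal_density 0 (sqrt (N0 / 2)) z)))"

text \<open>Joint law of the mutually independent bits, fading and noise.\<close>

definition channel_law ::
  "nat \<Rightarrow> nat \<Rightarrow> (nat \<Rightarrow> real) measure \<Rightarrow> real \<Rightarrow>
     ((nat \<Rightarrow> nat) \<times> (nat \<Rightarrow> real) \<times> (nat \<Rightarrow> real)) measure" where
  "channel_law m N \<nu> N0 = measure_pmf (uniform_bits m) \<Otimes>\<^sub>M (\<nu> \<Otimes>\<^sub>M gaussian_noise N N0)"

definition channel_output ::
  "nat \<Rightarrow> (nat \<Rightarrow> real) \<Rightarrow> real vec \<Rightarrow> (nat \<Rightarrow> real) \<Rightarrow> nat \<Rightarrow> real" where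
  "channel_output N h x z = (\<lambda>j\<in>{..<N}. h j * x $ j + z j)"

text \<open>The density \<open>p(y | x, h)\<close> of \<open>Y\<close> given \<open>X = x\<close> and \<open>H = h\<close>, i.e. of the independent
  Gaussian components \<open>h\<^sub>j x\<^sub>j + Z\<^sub>j\<close>. The densities \<open>p(y | h)\<close> and \<open>p(y | C\<^sub>k = b, h)\<close> are its
  averages over the law of the bits and over that law conditioned on \<open>C\<^sub>k = b\<close>.\<close>

definition dens_given_symbol ::
  "nat \<Rightarrow> real \<Rightarrow> real vec \<Rightarrow> (nat \<Rightarrow> real) \<Rightarrow> (nat \<Rightarrow> real) \<Rightarrow> real" where
  "dens_given_symbol N N0 x h y =
     (\<Prod>j<N. normal_density (h j * x $ j) (sqrt (N0 / 2)) (y j))"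

definition dens ::
  "real mat \<Rightarrow> nat mat \<Rightarrow> real \<Rightarrow> (nat \<Rightarrow> real) \<Rightarrow> (nat \<Rightarrow> real) \<Rightarrow> real" where
  "dens X L N0 h y =
     measure_pmf.expectation (uniform_bits (dim_col L))
       (\<lambda>c. dens_given_symbol (dim_col X) N0 (symbol X L c) h y)"

definition dens_given_bit ::
  "real mat \<Rightarrow> nat mat \<Rightarrow> real \<Rightarrow> nat \<Rightarrow> nat \<Rightarrow> (nat \<Rightarrow> real) \<Rightarrow> (nat \<Rightarrow> real) \<Rightarrow> real" where
  "dens_given_bit X L N0 k b h y =
     measure_pmf.expectation (cond_pmf (uniform_bits (dim_col L)) {c. c k = b})
       (\<lambda>c. dens_given_symbol (dim_col X) N0 (symbol X L c) h y)"

definition bicm_information ::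
  "real mat \<Rightarrow> nat mat \<Rightarrow> (nat \<Rightarrow> real) measure \<Rightarrow> real \<Rightarrow> real" where
  "bicm_information X L \<nu> N0 =
     (\<Sum>k<dim_col L. \<integral>(c, h, z).
        (let y = channel_output (dim_col X) h (symbol X L c) z
         in log 2 (dens_given_bit X L N0 k (c k) h y / dens X L N0 h y))
        \<partial>channel_law (dim_col L) (dim_col X) \<nu> N0)"

text \<open>The capacity at a given SNR is the one at noise level \<open>N0 = E[H\<^sup>2] E\<^sub>s / SNR\<close>.\<close>

definition bicm_capacity ::
  "real mat \<Rightarrow> nat mat \<Rightarrow> (nat \<Rightarrow> real) measure \<Rightarrow> real measure \<Rightarrow> real \<Rightarrow> real" where
  "bicm_capacity X L \<nu> \<eta> snr =
     bicm_information X L \<nu> ((\<integral>x. x\<^sup>2 \<partial>\<eta>) * symbol_energy X L / snr)"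

definition bicm_first_order ::
  "real mat \<Rightarrow> nat mat \<Rightarrow> (nat \<Rightarrow> real) measure \<Rightarrow> real measure \<Rightarrow> real \<Rightarrow> bool" where
  "bicm_first_order X L \<nu> \<eta> a \<longleftrightarrow>
     (\<lambda>snr. bicm_capacity X L \<nu> \<eta> snr - a * snr) \<in> O[at_right 0](\<lambda>snr. snr\<^sup>2)"

definition bicm_coefficient ::
  "real mat \<Rightarrow> nat mat \<Rightarrow> (nat \<Rightarrow> real) measure \<Rightarrow> real measure \<Rightarrow> real" where
  "bicm_coefficient X L \<nu> \<eta> = (THE a. bicm_first_order X L \<nu> \<eta> a)"

lemma bicm_first_order_unique:
  assumes "bicm_first_order X L \<nu> \<eta> a" and "bicm_first_order X L \<nu> \<eta> b"
  shows "a = b"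
proof (rule ccontr)
  assume "a \<noteq> b"
  have "(\<lambda>snr. (a - b) * snr) \<in> O[at_right 0](\<lambda>snr::real. snr\<^sup>2)"
    using sum_in_bigo(2)[OF assms(2)[unfolded bicm_first_order_def]
                            assms(1)[unfolded bicm_first_order_def]]
    by (simp add: algebra_simps)
  hence "(\<lambda>snr. snr) \<in> O[at_right 0](\<lambda>snr::real. snr\<^sup>2)"
    using \<open>a \<noteq> b\<close> by simp
  moreover have "(\<lambda>snr. snr\<^sup>2) \<in> o[at_right 0](\<lambda>snr::real. snr)"
    by real_asymp
  ultimately have "(\<lambda>snr. snr) \<in> o[at_right 0](\<lambda>snr::real. snr)"
    by (rule landau_o.big_small_trans)
  hence "eventually (\<lambda>snr::real. snr = 0) (at_right 0)"
    by (simp add: landau_o.small_refl_iff)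
  moreover have "eventually (\<lambda>snr::real. snr > 0) (at_right 0)"
    by (rule eventually_at_right_less)
  ultimately have "eventually (\<lambda>snr::real. False) (at_right 0)"
    by eventually_elim simp
  thus False by simp
qed

lemma bicm_coefficient_eqI:
  "bicm_first_order X L \<nu> \<eta> a \<Longrightarrow> bicm_coefficient X L \<nu> \<eta> = a"
  unfolding bicm_coefficient_def
  by (rule the_equality) (auto intro: bicm_first_order_unique)

definition first_order_optimal ::
  "real mat \<Rightarrow> nat mat \<Rightarrow> (nat \<Rightarrow> real) measure \<Rightarrow> real measure \<Rightarrow> bool" where
  "first_order_optimal X L \<nu> \<eta> \<longleftrightarrow> bicm_coefficient X L \<nu> \<eta> = log 2 (exp 1)"

text \<open>\<open>\<nu>\<close> is the law of a fading vector in \<open>\<real>\<^sup>N\<close> whose (possibly dependent) components all have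
  law \<open>\<eta>\<close>, with a finite nonzero second moment, and whose norm has stretched-exponential tails.\<close>

definition fading_law :: "nat \<Rightarrow> (nat \<Rightarrow> real) measure \<Rightarrow> real measure \<Rightarrow> bool" where
  "fading_law N \<nu> \<eta> \<longleftrightarrow>
     prob_space \<nu> \<and> sets \<nu> = sets (Pi\<^sub>M {..<N} (\<lambda>_. borel)) \<and>
     (\<forall>j<N. distr \<nu> borel (\<lambda>h. h j) = \<eta>) \<and>
     integrable \<eta> (\<lambda>x. x\<^sup>2) \<and> 0 < (\<integral>x. x\<^sup>2 \<partial>\<eta>) \<and>
     (\<exists>\<omega>>0. \<forall>\<^sub>F \<Delta> in at_top.
        measure \<nu> {h \<in> space \<nu>. (\<Sum>j<N. (h j)\<^sup>2) > \<Delta>} \<le> exp (- (\<Delta> powr \<omega>)))"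

end

(* Let Q_k = 1 or -1 according to the bit C_k, and let d = E[Q_k | Y, H]. The information about the
   bit is the mean of phi(d) = d^2/2 + O(d^4), the divergence of (1 + d)/2, (1 - d)/2 from the
   uniform law. Relative to pure noise, Y has likelihood P = E_x[l_x] and Q_k has signed likelihood
   D = E_x[Q_k l_x], where l_x is the Cameron-Martin density of the noise shifted by h x and
   d = D/P. For fixed h, P phi(D/P) agrees with D^2 (2 - P)/2 up to a fourth-order term in the
   amplitude |h|/sqrt(N0), and Gaussian exponential moments give the integral of the latter as
   sum_j h_j^2 E[Q_k X_j]^2 / N0 up to fourth order. For large amplitudes the estimate is trivial
   because the information of a bit is bounded. The tail assumption gives E|H|^4 < infinity, so the
   error is O(1/N0^2) on average over H, and the coefficient is
   log2(e) sum_{k,j} E[Q_k X_j]^2 / Es. The signs Q_k are orthonormal, so Bessel's inequality bounds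
   it by log2(e), with equality exactly if every X_j is a linear combination of the Q_k. *)

theory Submission
  imports Defs
begin

section \<open>Elementary estimates\<close>

text \<open>An error of order SNR^2 means order t^4 in the amplitude t, and this dictates the
  approximation. Replacing P phi(D/P) by D^2/2 would leave a pointwise error of order three, which a
  bound on absolute values cannot remove. Linearizing 1/P at P = 1 as 2 - P leaves order four
  pointwise, and the approximant is a polynomial in the likelihoods, so its Gaussian integral is
  explicit, unlike that of D^2/P. The other constraint is uniformity. The fading is unbounded, so
  the estimate for fixed h must hold for every h with a constant free of h and N0; only then can it
  be averaged against the fourth moment of |H|. The pointwise errors grow exponentially in the
  noise, at a rate proportional to 1/sqrt(N0). In units of the noise deviation this rate is fixed,
  and the Gaussian integral of the error is a number depending on N alone.\<close>

lemma exp_minus_one_bound: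
  fixes a T :: real
  assumes "\<bar>a\<bar> \<le> T"
  shows "\<bar>exp a - 1\<bar> \<le> T * exp T"
proof -
  obtain t where t: "\<bar>t\<bar> \<le> \<bar>a\<bar>" "exp a = (\<Sum>i<1. a ^ i / fact i) + exp t / fact 1 * a ^ 1"
    using Maclaurin_exp_le[of a 1] by blast
  have "\<bar>exp a - 1\<bar> = \<bar>a\<bar> * exp t"
    using t(2) by (simp add: abs_mult)
  also have "\<dots> \<le> T * exp T"
    using assms t(1) by (intro mult_mono) auto
  finally show ?thesis .
qed

lemma exp_minus_linear_bound:
  fixes a T :: real
  assumes "\<bar>a\<bar> \<le> T"
  shows "\<bar>exp a - 1 - a\<bar> \<le> T\<^sup>2 * exp T"
proof -
  obtain t where t: "\<bar>t\<bar> \<le> \<bar>a\<bar>" "exp a = (\<Sum>i<2. a ^ i / fact i) + exp t / fact 2 * a ^ 2"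
    using Maclaurin_exp_le[of a 2] by blast
  have "\<bar>exp a - 1 - a\<bar> = a\<^sup>2 * exp t / 2"
    using t(2) by (simp add: abs_mult numeral_2_eq_2)
  also have "\<dots> \<le> a\<^sup>2 * exp t"
    by simp
  also have "\<dots> \<le> T\<^sup>2 * exp T"
    using assms t(1) power_mono[OF assms, of 2] by (intro mult_mono) auto
  finally show ?thesis .
qed

text \<open>The fourth-order term of the exponential series alone. It converts polynomial growth in
  the noise into exponential growth, for which Gaussian integrals are at hand.\<close>

lemma fourth_power_le_exp:
  fixes x :: real
  assumes "0 \<le> x"
  shows "x ^ 4 \<le> 24 * exp x"
proof -
  obtain t where t: "exp x = (\<Sum>i<5. x ^ i / fact i) + exp t / fact 5 * x ^ 5"
    using Maclaurin_exp_le[of x 5] by blast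
  have "(\<Sum>i<5. x ^ i / fact i) = 1 + x + x\<^sup>2 / 2 + x ^ 3 / 6 + x ^ 4 / 24"
    by (simp add: eval_nat_numeral field_simps)
  moreover have "0 \<le> exp t / fact 5 * x ^ 5" "0 \<le> x ^ 3" "0 \<le> x\<^sup>2"
    using assms by auto
  ultimately show ?thesis
    using t assms by linarith
qed

lemma abs_mult_ln_le:
  fixes x :: real
  assumes "0 < x" "x \<le> 2"
  shows "\<bar>x * ln x\<bar> \<le> 2"
proof -
  have "- ln x = ln (1 / x)"
    using assms by (simp add: ln_div)
  also have "\<dots> \<le> 1 / x - 1"
    using assms ln_le_minus_one[of "1 / x"] by simp
  finally have "x * (- ln x) \<le> x * (1 / x - 1)"
    using assms by (intro mult_left_mono) auto
  hence "- (x * ln x) \<le> 1"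
    using assms by (simp add: algebra_simps)
  moreover have "x * ln x \<le> 2"
  proof -
    have "ln x \<le> 1"
      using assms ln_le_minus_one[of x] by linarith
    thus ?thesis
      using assms mult_mono[of x 2 "ln x" 1] mult_left_mono[of "ln x" 1 x] by linarith
  qed
  ultimately show ?thesis by linarith
qed

text \<open>The Kullback-Leibler divergence, in nats, of the bit law \<open>((1 + d) / 2, (1 - d) / 2)\<close> from
  the uniform one.\<close>

definition bit_divergence :: "real \<Rightarrow> real" where
  "bit_divergence d = ((1 + d) * ln (1 + d) + (1 - d) * ln (1 - d)) / 2"

lemma bit_divergence_minus: "bit_divergence (- d) = bit_divergence d"
  by (simp add: bit_divergence_def)

lemma bit_divergence_le:
  assumes "\<bar>d\<bar> < 1"
  shows "bit_divergence d \<le> 1"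
proof -
  have "ln (1 + d) \<le> d" "ln (1 - d) \<le> - d"
    using assms ln_le_minus_one[of "1 + d"] ln_le_minus_one[of "1 - d"] by auto
  hence "(1 + d) * ln (1 + d) \<le> (1 + d) * d" "(1 - d) * ln (1 - d) \<le> (1 - d) * (- d)"
    using assms by (intro mult_left_mono; linarith)+
  hence "bit_divergence d \<le> d\<^sup>2"
    by (simp add: bit_divergence_def power2_eq_square algebra_simps)
  also have "\<dots> \<le> 1"
    using assms by (simp add: abs_square_le_1)
  finally show ?thesis .
qed

text \<open>With \<open>f\<close> the error, \<open>f' = g\<close> is artanh x - x and
  \<open>g' = x^2 / (1 - x^2)\<close>, so comparing derivatives twice gives
  \<open>f x \<le> x ^ 4\<close> up to 1/2. Beyond 1/2 the divergence is at most 1, while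
  \<open>16 * x ^ 4\<close> is at least 1; this is the origin of 16. Evenness covers negative
  arguments.\<close>

lemma bit_divergence_quadratic:
  assumes "\<bar>d\<bar> < 1"
  shows "\<bar>bit_divergence d - d\<^sup>2 / 2\<bar> \<le> 16 * d ^ 4" and "0 \<le> bit_divergence d"
proof -
  define f where "f x = bit_divergence x - x\<^sup>2 / 2" for x
  define g where "g x = (ln (1 + x) - ln (1 - x)) / 2 - x" for x :: real
  have df: "(f has_real_derivative g x) (at x)" if "0 \<le> x" "x < 1" for x
  proof -
    have "(f has_real_derivative
        ((1 + x) * (1 / (1 + x)) + ln (1 + x) + ((1 - x) * (- 1 / (1 - x)) - ln (1 - x))) / 2 - x) (at x)"
      unfolding f_def bit_divergence_def using that
      by (auto intro!: derivative_eq_intros)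
    thus ?thesis using that by (simp add: g_def)
  qed
  have dg: "(g has_real_derivative x\<^sup>2 / (1 - x\<^sup>2)) (at x)" if "0 \<le> x" "x < 1" for x
  proof -
    have "1 - x\<^sup>2 = (1 + x) * (1 - x)"
      by (simp add: algebra_simps power2_eq_square)
    thus ?thesis
      unfolding g_def using that
      by (auto intro!: derivative_eq_intros simp: divide_simps)
  qed
  have sq: "x\<^sup>2 < 1" if "0 \<le> x" "x < 1" for x :: real
    using that by (simp add: power_less_one_iff abs_square_less_1)
  have g0: "0 \<le> g x" if "0 \<le> x" "x < 1" for x
  proof -
    have "g 0 \<le> g x"
    proof (rule DERIV_nonneg_imp_nondecreasing[OF that(1)])
      fix y assume "0 \<le> y" "y \<le> x"
      thus "\<exists>z. DERIV g y :> z \<and> 0 \<le> z"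
        using dg[of y] sq[of y] that by (intro exI[of _ "y\<^sup>2 / (1 - y\<^sup>2)"]) auto
    qed
    thus ?thesis by (simp add: g_def)
  qed
  have g1: "g x \<le> x ^ 3" if "0 \<le> x" "x \<le> 1 / 2" for x
  proof -
    have "0 ^ 3 - g 0 \<le> x ^ 3 - g x"
    proof (rule DERIV_nonneg_imp_nondecreasing[OF that(1)])
      fix y assume y: "0 \<le> y" "y \<le> x"
      \<comment> \<open>On this range 1 / (1 - y^2) is at most 4/3, hence below the factor 3 that
        comes from differentiating \<open>x ^ 3\<close>.\<close>
      have "y\<^sup>2 \<le> (1 / 2)\<^sup>2"
        using y that by (intro power_mono) auto
      hence "y\<^sup>2 * 1 \<le> y\<^sup>2 * (3 * (1 - y\<^sup>2))"
        by (intro mult_left_mono) (auto simp: power2_eq_square)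
      moreover have "y\<^sup>2 < 1"
        using \<open>y\<^sup>2 \<le> (1 / 2)\<^sup>2\<close> by (simp add: power2_eq_square)
      ultimately have "y\<^sup>2 / (1 - y\<^sup>2) \<le> 3 * y\<^sup>2"
        by (simp add: pos_divide_le_eq algebra_simps)
      thus "\<exists>z. DERIV (\<lambda>x. x ^ 3 - g x) y :> z \<and> 0 \<le> z"
        using dg[of y] y that
        by (intro exI[of _ "3 * y\<^sup>2 - y\<^sup>2 / (1 - y\<^sup>2)"]) (auto intro!: derivative_eq_intros)
    qed
    thus ?thesis by (simp add: g_def)
  qed
  have f0: "0 \<le> f x" if "0 \<le> x" "x < 1" for x
  proof -
    have "f 0 \<le> f x"
    proof (rule DERIV_nonneg_imp_nondecreasing[OF that(1)])
      fix y assume "0 \<le> y" "y \<le> x"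
      thus "\<exists>z. DERIV f y :> z \<and> 0 \<le> z"
        using df[of y] g0[of y] that by (intro exI[of _ "g y"]) auto
    qed
    thus ?thesis by (simp add: f_def bit_divergence_def)
  qed
  have f1: "f x \<le> x ^ 4" if "0 \<le> x" "x \<le> 1 / 2" for x
  proof -
    have "0 ^ 4 - f 0 \<le> x ^ 4 - f x"
    proof (rule DERIV_nonneg_imp_nondecreasing[OF that(1)])
      fix y assume y: "0 \<le> y" "y \<le> x"
      have "g y \<le> 4 * y ^ 3"
        using g1[of y] y that zero_le_power[of y 3] by linarith
      thus "\<exists>z. DERIV (\<lambda>x. x ^ 4 - f x) y :> z \<and> 0 \<le> z"
        using df[of y] y that
        by (intro exI[of _ "4 * y ^ 3 - g y"]) (auto intro!: derivative_eq_intros)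
    qed
    thus ?thesis by (simp add: f_def bit_divergence_def)
  qed
  have f2: "f x \<le> 16 * x ^ 4" if "0 \<le> x" "x < 1" for x
  proof (cases "x \<le> 1 / 2")
    case True
    thus ?thesis using f1[of x] that zero_le_power[of x 4] by linarith
  next
    case False
    have "(1 / 2) ^ 4 \<le> x ^ 4"
      using False by (intro power_mono) auto
    hence "1 \<le> 16 * x ^ 4"
      by (simp add: power_divide)
    moreover have "f x \<le> 1"
      using bit_divergence_le[of x] that zero_le_power2[of x] unfolding f_def by linarith
    ultimately show ?thesis by linarith
  qed
  have f_abs: "f \<bar>d\<bar> = f d"
    by (cases "0 \<le> d") (auto simp: f_def bit_divergence_minus)
  show "\<bar>bit_divergence d - d\<^sup>2 / 2\<bar> \<le> 16 * d ^ 4"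
    using f0[of "\<bar>d\<bar>"] f2[of "\<bar>d\<bar>"] assms by (simp add: f_abs) (simp add: f_def)
  have "0 \<le> f d"
    using f0[of "\<bar>d\<bar>"] assms by (simp add: f_abs)
  thus "0 \<le> bit_divergence d"
    using zero_le_power2[of d] unfolding f_def by linarith
qed

text \<open>Slicing by integer levels: the square is at most (n + 1)^2 where n < f \<le> n + 1, and
  the sum of (n + 1)^2 P(f > n) converges for every positive exponent \<open>\<omega>\<close>. Taken
  with f = |H|^2 it yields the fourth moment of the fading norm.\<close>

lemma integrable_square_of_exponential_tail:
  fixes f :: "'a \<Rightarrow> real"
  assumes "prob_space M" and f [measurable]: "f \<in> borel_measurable M" and nonneg: "\<And>x. 0 \<le> f x" and "0 < \<omega>"
    and tail: "\<forall>\<^sub>F \<Delta> in at_top. measure M {x \<in> space M. f x > \<Delta>} \<le> exp (- (\<Delta> powr \<omega>))"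
  shows "integrable M (\<lambda>x. (f x)\<^sup>2)"
proof (rule integrableI_bounded)
  interpret prob_space M by fact
  let ?p = "\<lambda>n. prob {x \<in> space M. f x > real n}"
  have "eventually (\<lambda>n::nat. ?p n \<le> exp (- (real n powr \<omega>))) sequentially"
    using tail by (rule eventually_compose_filterlim) (rule filterlim_real_sequentially)
  hence "eventually (\<lambda>n. norm ((real n + 1)\<^sup>2 * ?p n) \<le> (real n + 1)\<^sup>2 * exp (- (real n powr \<omega>))) sequentially"
    by eventually_elim (auto simp: abs_mult intro!: mult_left_mono)
  moreover have "summable (\<lambda>n. (real n + 1)\<^sup>2 * exp (- (real n powr \<omega>)))"
  proof (rule summable_comparison_test_bigo)
    show "summable (\<lambda>n. norm (inverse (real n ^ 2)))"
      using inverse_power_summable[of 2, where 'a = real] by simp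
    show "(\<lambda>n. (real n + 1)\<^sup>2 * exp (- (real n powr \<omega>))) \<in> O(\<lambda>n. inverse (real n ^ 2))"
      using \<open>0 < \<omega>\<close> by real_asymp
  qed
  ultimately have summable: "summable (\<lambda>n. (real n + 1)\<^sup>2 * ?p n)"
    by (rule summable_comparison_test_ev)
  have "ennreal (norm ((f x)\<^sup>2)) \<le> (\<Sum>n. ennreal ((real n + 1)\<^sup>2) * indicator {x \<in> space M. f x > real n} x)"
    if "x \<in> space M" for x
  proof (cases "f x = 0")
    case False
    \<comment> \<open>Ceiling minus one rather than floor, so that \<open>n < f x\<close> is strict
      and \<open>x\<close> lies in the n-th level set. As \<open>f x\<close> is positive, the
      natural subtraction does not truncate.\<close>
    define n where "n = nat \<lceil>f x\<rceil> - 1"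
    have "0 < f x" using False nonneg[of x] by simp
    hence n: "real n < f x" "f x \<le> real n + 1"
      unfolding n_def by linarith+
    have "ennreal (norm ((f x)\<^sup>2)) \<le> ennreal ((real n + 1)\<^sup>2)"
      using n(2) nonneg[of x] by (intro ennreal_leI) (simp add: power_mono)
    also have "\<dots> = (\<Sum>i\<in>{n}. ennreal ((real i + 1)\<^sup>2) * indicator {x \<in> space M. f x > real i} x)"
      using that n(1) by simp
    also have "\<dots> \<le> (\<Sum>n. ennreal ((real n + 1)\<^sup>2) * indicator {x \<in> space M. f x > real n} x)"
      by (rule sum_le_suminf) auto
    finally show ?thesis .
  qed simp
  hence "(\<integral>\<^sup>+x. ennreal (norm ((f x)\<^sup>2)) \<partial>M) \<le>
      (\<integral>\<^sup>+x. (\<Sum>n. ennreal ((real n + 1)\<^sup>2) * indicator {x \<in> space M. f x > real n} x) \<partial>M)"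
    by (rule nn_integral_mono)
  also have "\<dots> = (\<Sum>n. \<integral>\<^sup>+x. ennreal ((real n + 1)\<^sup>2) * indicator {x \<in> space M. f x > real n} x \<partial>M)"
    by (rule nn_integral_suminf) auto
  also have "\<dots> = (\<Sum>n. ennreal ((real n + 1)\<^sup>2 * ?p n))"
    by (simp add: nn_integral_cmult_indicator emeasure_eq_measure ennreal_mult)
  also have "\<dots> < \<infinity>"
    unfolding infinity_ennreal_def less_top[symmetric] by (rule ennreal_suminf_neq_top[OF summable]) simp
  finally show "(\<integral>\<^sup>+x. ennreal (norm ((f x)\<^sup>2)) \<partial>M) < \<infinity>" .
qed measurable

section \<open>Gaussian noise\<close>

definition gaussian_component :: "real \<Rightarrow> real measure" where
  "gaussian_component N0 = density lborel (\<lambda>z. ennreal (normal_density 0 (sqrt (N0 / 2)) z))"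

lemma gaussian_noise_eq: "gaussian_noise N N0 = PiM {..<N} (\<lambda>_. gaussian_component N0)"
  by (simp add: gaussian_noise_def gaussian_component_def)

lemma sets_gaussian_component [simp, measurable_cong]: "sets (gaussian_component N0) = sets borel"
  by (simp add: gaussian_component_def)

lemma space_gaussian_component [simp]: "space (gaussian_component N0) = UNIV"
  by (simp add: gaussian_component_def)

lemma prob_space_gaussian_component: "0 < N0 \<Longrightarrow> prob_space (gaussian_component N0)"
  unfolding gaussian_component_def by (rule prob_space_normal_density) simp

lemma sets_gaussian_noise [simp, measurable_cong]:
  "sets (gaussian_noise N N0) = sets (PiM {..<N} (\<lambda>_. borel))"
  unfolding gaussian_noise_eq by (intro sets_PiM_cong) auto

lemma space_gaussian_noise: "space (gaussian_noise N N0) = space (PiM {..<N} (\<lambda>_. borel))"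
  by (rule sets_eq_imp_space_eq) simp

lemma prob_space_gaussian_noise: "0 < N0 \<Longrightarrow> prob_space (gaussian_noise N N0)"
  unfolding gaussian_noise_eq by (intro prob_space_PiM prob_space_gaussian_component)

text \<open>With variance \<open>N0 / 2\<close> the exponent of the centred density is -x^2 / N0,
  and expanding the square of x - a leaves an affine exponent. Every likelihood ratio below has this
  form.\<close>

lemma normal_density_tilt:
  assumes "0 < N0"
  shows "normal_density a (sqrt (N0 / 2)) x =
    normal_density 0 (sqrt (N0 / 2)) x * exp ((2 * a * x - a\<^sup>2) / N0)"
proof -
  have "- (x - a)\<^sup>2 / N0 = - x\<^sup>2 / N0 + (2 * a * x - a\<^sup>2) / N0"
    by (simp add: power2_eq_square algebra_simps flip: add_divide_distrib)
  thus ?thesis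
    using assms by (simp add: normal_density_def real_sqrt_pow2 flip: exp_add)
qed

text \<open>Tilting the centred density by \<open>exp (v * x)\<close> recentres it at
  \<open>N0 * v / 2\<close>; the integral is the normalizing factor that this leaves.\<close>

lemma gaussian_component_mgf:
  assumes "0 < N0"
  shows "has_bochner_integral (gaussian_component N0) (\<lambda>x. exp (v * x)) (exp (N0 * v\<^sup>2 / 4))"
proof -
  let ?a = "N0 * v / 2"
  have "exp (v * x) * normal_density 0 (sqrt (N0 / 2)) x =
      exp (N0 * v\<^sup>2 / 4) * normal_density ?a (sqrt (N0 / 2)) x" for x
  proof -
    have "N0 * v\<^sup>2 / 4 + (2 * ?a * x - ?a\<^sup>2) / N0 = v * x"
      using assms by (simp add: field_simps power2_eq_square)
    thus ?thesis
      using normal_density_tilt[OF assms, of ?a x] by (simp add: mult_ac flip: exp_add)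
  qed
  moreover have "has_bochner_integral lborel (\<lambda>x. exp (N0 * v\<^sup>2 / 4) * normal_density ?a (sqrt (N0 / 2)) x)
      (exp (N0 * v\<^sup>2 / 4) * 1)"
    using assms by (intro has_bochner_integral_mult_right) (simp add: has_bochner_integral_iff)
  ultimately show ?thesis
    unfolding gaussian_component_def
    by (intro has_bochner_integral_density) (auto simp: mult_ac)
qed

lemma gaussian_noise_prod:
  fixes f :: "nat \<Rightarrow> real \<Rightarrow> real"
  assumes "0 < N0" and "\<And>j. j < N \<Longrightarrow> has_bochner_integral (gaussian_component N0) (f j) (I j)"
  shows "has_bochner_integral (gaussian_noise N N0) (\<lambda>u. \<Prod>j<N. f j (u j)) (\<Prod>j<N. I j)"
proof -
  interpret product_prob_space "\<lambda>_. gaussian_component N0" "{..<N}"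
    by (rule product_prob_spaceI) (rule prob_space_gaussian_component[OF assms(1)])
  show ?thesis
    using assms(2) unfolding gaussian_noise_eq
    by (auto simp: has_bochner_integral_iff intro!: product_integrable_prod)
       (subst product_integral_prod, auto)
qed

lemma gaussian_noise_mgf:
  assumes "0 < N0"
  shows "has_bochner_integral (gaussian_noise N N0) (\<lambda>u. exp (\<Sum>j<N. v j * u j))
    (exp (N0 * (\<Sum>j<N. (v j)\<^sup>2) / 4))"
  using gaussian_noise_prod[OF assms gaussian_component_mgf[OF assms], of N v]
  by (simp add: exp_sum sum_distrib_left sum_divide_distrib)

text \<open>The integrand majorizes the exponential of the l1 norm of the noise: each absolute value
  is replaced by the sum over both signs, so that the integral is explicit.\<close>

lemma gaussian_noise_exp_abs:
  assumes "0 < N0" "0 \<le> l"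
  shows "has_bochner_integral (gaussian_noise N N0)
    (\<lambda>u. \<Prod>j<N. exp (l * u j) + exp (- l * u j)) ((2 * exp (N0 * l\<^sup>2 / 4)) ^ N)"
proof -
  have "has_bochner_integral (gaussian_component N0) (\<lambda>x. exp (l * x) + exp (- l * x))
      (exp (N0 * l\<^sup>2 / 4) + exp (N0 * (- l)\<^sup>2 / 4))"
    by (intro has_bochner_integral_add gaussian_component_mgf assms)
  thus ?thesis
    using gaussian_noise_prod[OF assms(1), of N "\<lambda>_ x. exp (l * x) + exp (- l * x)" "\<lambda>_. 2 * exp (N0 * l\<^sup>2 / 4)"]
    by (simp add: power_mult_distrib)
qed

lemma exp_sum_abs_le:
  fixes l :: real and u :: "nat \<Rightarrow> real"
  assumes "0 \<le> l"
  shows "exp (l * (\<Sum>j<N. \<bar>u j\<bar>)) \<le> (\<Prod>j<N. exp (l * u j) + exp (- l * u j))"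
proof -
  have "exp (l * (\<Sum>j<N. \<bar>u j\<bar>)) = (\<Prod>j<N. exp (l * \<bar>u j\<bar>))"
    by (simp add: sum_distrib_left exp_sum)
  also have "\<dots> \<le> (\<Prod>j<N. exp (l * u j) + exp (- l * u j))"
    by (intro prod_mono) (auto simp: abs_if)
  finally show ?thesis .
qed

lemma gaussian_component_shift:
  assumes "0 < N0" and [measurable]: "A \<in> sets borel"
  shows "emeasure (distr (gaussian_component N0) borel (\<lambda>z. a + z)) A =
    (\<integral>\<^sup>+x. ennreal (exp ((2 * a * x - a\<^sup>2) / N0)) * indicator A x \<partial>gaussian_component N0)"
proof -
  let ?n = "normal_density 0 (sqrt (N0 / 2))"
  have tilt: "?n (- a + x) = ?n x * exp ((2 * a * x - a\<^sup>2) / N0)" for x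
  proof -
    have "?n (- a + x) = normal_density a (sqrt (N0 / 2)) x"
      by (simp add: normal_density_def)
    thus ?thesis by (simp only: normal_density_tilt[OF assms(1), of a])
  qed
  have "emeasure (distr (gaussian_component N0) borel (\<lambda>z. a + z)) A =
      (\<integral>\<^sup>+x. indicator A x \<partial>distr (gaussian_component N0) borel (\<lambda>z. a + z))"
    by simp
  also have "\<dots> = (\<integral>\<^sup>+z. indicator A (a + z) \<partial>gaussian_component N0)"
    by (rule nn_integral_distr) auto
  also have "\<dots> = (\<integral>\<^sup>+z. ennreal (?n z) * indicator A (a + z) \<partial>lborel)"
    unfolding gaussian_component_def by (subst nn_integral_density) auto
  also have "\<dots> = (\<integral>\<^sup>+x. ennreal (?n (- a + x)) * indicator A x \<partial>lborel)"
    by (subst nn_integral_real_affine[where c = 1 and t = "- a"]) auto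
  also have "\<dots> = (\<integral>\<^sup>+x. ennreal (?n x) * (ennreal (exp ((2 * a * x - a\<^sup>2) / N0)) * indicator A x) \<partial>lborel)"
    unfolding tilt by (intro nn_integral_cong) (simp add: ennreal_mult mult_ac)
  also have "\<dots> = (\<integral>\<^sup>+x. ennreal (exp ((2 * a * x - a\<^sup>2) / N0)) * indicator A x \<partial>gaussian_component N0)"
    unfolding gaussian_component_def by (subst nn_integral_density) auto
  finally show ?thesis .
qed

text \<open>Both measures are identified with the product of the shifted components, by their values
  on rectangles. The quadratic exponent splits over the coordinates, which reduces the claim to one
  dimension.\<close>

lemma gaussian_noise_shift:
  assumes "0 < N0"
  shows "distr (gaussian_noise N N0) (PiM {..<N} (\<lambda>_. borel)) (\<lambda>z. \<lambda>j\<in>{..<N}. w j + z j) =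
    density (gaussian_noise N N0) (\<lambda>u. ennreal (exp ((2 * (\<Sum>j<N. w j * u j) - (\<Sum>j<N. (w j)\<^sup>2)) / N0)))"
    (is "?D = ?E")
proof -
  let ?G = "gaussian_component N0" and ?S = "\<lambda>j. distr (gaussian_component N0) borel (\<lambda>z. w j + z)"
  interpret G: product_prob_space "\<lambda>_. ?G" "{..<N}"
    by (rule product_prob_spaceI) (rule prob_space_gaussian_component[OF assms])
  have "prob_space (?S j)" for j
    by (intro prob_space.prob_space_distr prob_space_gaussian_component assms) auto
  then interpret S: product_prob_space ?S "{..<N}"
    by (rule product_prob_spaceI)
  have [simp]: "sets (PiM {..<N} ?S) = sets (PiM {..<N} (\<lambda>_. borel))"
    by (intro sets_PiM_cong) auto
  have tilt: "exp ((2 * (\<Sum>j<N. w j * u j) - (\<Sum>j<N. (w j)\<^sup>2)) / N0) =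
      (\<Prod>j<N. exp ((2 * w j * u j - (w j)\<^sup>2) / N0))" for u
    by (simp add: sum_distrib_left sum_subtractf sum_divide_distrib diff_divide_distrib mult_ac flip: exp_sum)
  have "?D = PiM {..<N} ?S"
  proof (rule S.PiM_eqI)
    fix A assume "\<And>j. j \<in> {..<N} \<Longrightarrow> A j \<in> sets (?S j)"
    hence [measurable]: "\<And>j. j \<in> {..<N} \<Longrightarrow> A j \<in> sets borel" by simp
    have "emeasure ?D (Pi\<^sub>E {..<N} A) =
        emeasure (gaussian_noise N N0) ((\<lambda>z. \<lambda>j\<in>{..<N}. w j + z j) -` Pi\<^sub>E {..<N} A \<inter> space (gaussian_noise N N0))"
      by (intro emeasure_distr sets_PiM_I_finite) auto
    also have "(\<lambda>z. \<lambda>j\<in>{..<N}. w j + z j) -` Pi\<^sub>E {..<N} A \<inter> space (gaussian_noise N N0) =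
        Pi\<^sub>E {..<N} (\<lambda>j. (\<lambda>z. w j + z) -` A j \<inter> space ?G)"
      by (auto simp: space_gaussian_noise space_PiM PiE_iff)
    also have "emeasure (gaussian_noise N N0) \<dots> = (\<Prod>j<N. emeasure ?G ((\<lambda>z. w j + z) -` A j \<inter> space ?G))"
      unfolding gaussian_noise_eq by (intro G.emeasure_PiM) (auto intro!: measurable_sets_borel simp del: space_gaussian_component)
    also have "\<dots> = (\<Prod>j<N. emeasure (?S j) (A j))"
      by (intro prod.cong emeasure_distr[symmetric]) auto
    finally show "emeasure ?D (Pi\<^sub>E {..<N} A) = (\<Prod>j<N. emeasure (?S j) (A j))" .
  qed auto
  also have "PiM {..<N} ?S = ?E"
  proof (rule S.PiM_eqI[symmetric])
    fix A assume "\<And>j. j \<in> {..<N} \<Longrightarrow> A j \<in> sets (?S j)"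
    hence A [measurable]: "\<And>j. j \<in> {..<N} \<Longrightarrow> A j \<in> sets borel" by simp
    have "emeasure ?E (Pi\<^sub>E {..<N} A) =
        (\<integral>\<^sup>+u. ennreal (\<Prod>j<N. exp ((2 * w j * u j - (w j)\<^sup>2) / N0)) * indicator (Pi\<^sub>E {..<N} A) u \<partial>gaussian_noise N N0)"
      unfolding tilt by (intro emeasure_density) (auto intro!: sets_PiM_I_finite)
    also have "\<dots> = (\<integral>\<^sup>+u. (\<Prod>j<N. ennreal (exp ((2 * w j * u j - (w j)\<^sup>2) / N0)) * indicator (A j) (u j)) \<partial>gaussian_noise N N0)"
      by (intro nn_integral_cong)
         (auto simp: prod.distrib prod_ennreal indicator_def space_gaussian_noise space_PiM PiE_iff split: if_splits)
    also have "\<dots> = (\<Prod>j<N. \<integral>\<^sup>+x. ennreal (exp ((2 * w j * x - (w j)\<^sup>2) / N0)) * indicator (A j) x \<partial>?G)"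
      unfolding gaussian_noise_eq by (intro G.product_nn_integral_prod) auto
    also have "\<dots> = (\<Prod>j<N. emeasure (?S j) (A j))"
      using A by (intro prod.cong gaussian_component_shift[OF assms, symmetric]) auto
    finally show "emeasure ?E (Pi\<^sub>E {..<N} A) = (\<Prod>j<N. emeasure (?S j) (A j))" .
  qed auto
  finally show ?thesis .
qed

section \<open>Information of one bit at low signal-to-noise ratio\<close>

text \<open>Two errors add up: 16 D^4 / P^3 from the divergence, and D^2 (P - 1)^2 / (2 P) from 1/P
  - (2 - P) = (P - 1)^2 / P. In the first, D^4 contributes \<open>exp (4 * T)\<close> and the cube
  of 1/P contributes \<open>exp (3 * T)\<close>, hence 7; the second is of the same order with a
  smaller exponent, hence 17 = 16 + 1.\<close>

lemma bit_divergence_expansion: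
  fixes P D T :: real
  assumes D: "\<bar>D\<bar> < P" "\<bar>D\<bar> \<le> T * exp T" and P: "\<bar>P - 1\<bar> \<le> T * exp T" "exp (- T) \<le> P"
  shows "\<bar>P * bit_divergence (D / P) - D\<^sup>2 * (2 - P) / 2\<bar> \<le> 17 * (T ^ 4 * exp (7 * T))"
proof -
  have "0 < P" using D by linarith
  have "0 \<le> T * exp T" using D(2) by linarith
  hence "0 \<le> T" by (simp add: zero_le_mult_iff)
  have inv: "1 / P \<le> exp T"
    using P(2) \<open>0 < P\<close> by (simp add: exp_minus field_simps)
  have D4: "D ^ 4 \<le> T ^ 4 * exp (4 * T)"
    using power_mono[OF D(2), of 4] by (simp add: power_mult_distrib flip: exp_of_nat_mult)
  have D2: "D\<^sup>2 \<le> T\<^sup>2 * exp (2 * T)"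
    using power_mono[OF D(2), of 2] by (simp add: power_mult_distrib flip: exp_of_nat_mult)
  have P2: "(P - 1)\<^sup>2 \<le> T\<^sup>2 * exp (2 * T)"
    using power_mono[OF P(1), of 2] by (simp add: power_mult_distrib flip: exp_of_nat_mult)
  have inv3: "(1 / P) ^ 3 \<le> exp (3 * T)"
    using power_mono[OF inv, of 3] \<open>0 < P\<close> by (simp add: flip: exp_of_nat_mult)
  have "\<bar>D / P\<bar> < 1"
    using D(1) \<open>0 < P\<close> by simp
  have "P * bit_divergence (D / P) - D\<^sup>2 * (2 - P) / 2 =
      P * (bit_divergence (D / P) - (D / P)\<^sup>2 / 2) + D\<^sup>2 * (P - 1)\<^sup>2 * (1 / P) / 2"
    using \<open>0 < P\<close> by (simp add: field_simps power2_eq_square)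
  also have "\<bar>\<dots>\<bar> \<le> P * (16 * (D / P) ^ 4) + D\<^sup>2 * (P - 1)\<^sup>2 * (1 / P) / 2"
    using bit_divergence_quadratic(1)[OF \<open>\<bar>D / P\<bar> < 1\<close>] \<open>0 < P\<close>
    by (intro order.trans[OF abs_triangle_ineq] add_mono) (auto simp: abs_mult)
  also have "P * (16 * (D / P) ^ 4) = 16 * (D ^ 4 * (1 / P) ^ 3)"
    using \<open>0 < P\<close> by (simp add: field_simps eval_nat_numeral)
  also have "D ^ 4 * (1 / P) ^ 3 \<le> (T ^ 4 * exp (4 * T)) * exp (3 * T)"
    using D4 inv3 \<open>0 < P\<close> \<open>0 \<le> T\<close> by (intro mult_mono) auto
  also have "\<dots> = T ^ 4 * exp (7 * T)"
    by (simp flip: exp_add)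
  also have "D\<^sup>2 * (P - 1)\<^sup>2 * (1 / P) / 2 \<le> D\<^sup>2 * (P - 1)\<^sup>2 * (1 / P)"
  proof -
    have half: "x / 2 \<le> x" if "0 \<le> x" for x :: real
      using that by simp
    show ?thesis
      by (rule half) (use \<open>0 < P\<close> in simp)
  qed
  also have "\<dots> \<le> (T\<^sup>2 * exp (2 * T)) * (T\<^sup>2 * exp (2 * T)) * exp T"
    using D2 P2 inv \<open>0 < P\<close> \<open>0 \<le> T\<close> by (intro mult_mono) auto
  also have "\<dots> = T ^ 4 * exp (5 * T)"
    by (simp add: eval_nat_numeral mult_ac flip: exp_add)
  also have "\<dots> \<le> T ^ 4 * exp (7 * T)"
    using \<open>0 \<le> T\<close> by (intro mult_left_mono) auto
  finally show ?thesis by linarith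
qed

text \<open>A channel input \<open>c\<close> is uniform on \<open>S\<close> and produces the noiseless output \<open>w c\<close>; the receiver
  is interested in the balanced bit with sign \<open>q c\<close>. All likelihoods below are relative to the
  law \<open>\<gamma>\<close> of the pure noise, so that \<open>signed_lik u / avg_lik u\<close> is the posterior mean of \<open>q\<close>
  and the integral of \<open>info_density\<close> is the mutual information, in nats, of the bit and the output.\<close>

locale binary_input =
  fixes S :: "'c set" and q :: "'c \<Rightarrow> real" and N :: nat and N0 :: real and w :: "'c \<Rightarrow> nat \<Rightarrow> real"
  assumes finite_S: "finite S" and nonempty: "S \<noteq> {}"
    and q_cases: "\<And>c. c \<in> S \<Longrightarrow> q c = 1 \<or> q c = -1" and sum_q: "(\<Sum>c\<in>S. q c) = 0"
    and N0_pos: "0 < N0"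
begin

abbreviation "\<gamma> \<equiv> gaussian_noise N N0"

definition lik :: "'c \<Rightarrow> (nat \<Rightarrow> real) \<Rightarrow> real" where
  "lik c u = exp ((2 * (\<Sum>j<N. w c j * u j) - (\<Sum>j<N. (w c j)\<^sup>2)) / N0)"

definition avg_lik :: "(nat \<Rightarrow> real) \<Rightarrow> real" where
  "avg_lik u = (\<Sum>c\<in>S. lik c u) / card S"

definition signed_lik :: "(nat \<Rightarrow> real) \<Rightarrow> real" where
  "signed_lik u = (\<Sum>c\<in>S. q c * lik c u) / card S"

definition info_density :: "(nat \<Rightarrow> real) \<Rightarrow> real" where
  "info_density u = avg_lik u * bit_divergence (signed_lik u / avg_lik u)"

text \<open>Half the difference between the mean noiseless outputs for the two values of the bit,
  since the bit is balanced.\<close>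

definition mean_shift :: "nat \<Rightarrow> real" where
  "mean_shift j = (\<Sum>c\<in>S. q c * w c j) / card S"

text \<open>The logarithm of the mean under \<gamma> of the product of the two likelihoods.\<close>

definition corr :: "'c \<Rightarrow> 'c \<Rightarrow> real" where
  "corr c c' = 2 * (\<Sum>j<N. w c j * w c' j) / N0"

section \<open>Positivity of the likelihoods and of their averages\<close>

lemma card_pos: "0 < card S"
  using finite_S nonempty by (simp add: card_gt_0_iff)

lemma lik_pos: "0 < lik c u"
  by (simp add: lik_def)

lemma measurable_lik [measurable]: "lik c \<in> borel_measurable \<gamma>"
  unfolding lik_def[abs_def] by measurable

lemma measurable_avg_lik [measurable]: "avg_lik \<in> borel_measurable \<gamma>"
  unfolding avg_lik_def[abs_def] by measurable

lemma measurable_signed_lik [measurable]: "signed_lik \<in> borel_measurable \<gamma>"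
  unfolding signed_lik_def[abs_def] by measurable

lemma measurable_info_density [measurable]: "info_density \<in> borel_measurable \<gamma>"
  unfolding info_density_def[abs_def] bit_divergence_def by measurable

text \<open>The right side averages \<open>(1 + q c * q c') * lik c' u\<close>, where inputs of the
  same sign as \<open>c\<close> have weight 2 and the others 0; the bound keeps only
  \<open>c\<close> itself. It makes the posterior nondegenerate, and it controls
  \<open>lik c\<close> where the posterior of the sign of \<open>c\<close> is small.\<close>

lemma avg_lik_signed_lik:
  assumes "c \<in> S"
  shows "2 * lik c u / card S \<le> avg_lik u + q c * signed_lik u"
proof -
  have "2 * lik c u = (1 + q c * q c) * lik c u"
    using q_cases[OF assms] by auto
  also have "\<dots> \<le> (\<Sum>c'\<in>S. (1 + q c * q c') * lik c' u)"
    using assms q_cases[of c] q_cases lik_pos[THEN less_imp_le] finite_S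
    by (intro member_le_sum[where f = "\<lambda>c'. (1 + q c * q c') * lik c' u"]) (fastforce intro!: mult_nonneg_nonneg)+
  also have "\<dots> = (\<Sum>c'\<in>S. lik c' u) + q c * (\<Sum>c'\<in>S. q c' * lik c' u)"
    by (simp add: algebra_simps sum.distrib sum_distrib_left)
  finally show ?thesis
    using card_pos by (simp add: avg_lik_def signed_lik_def divide_simps)
qed

lemma both_signs: "\<exists>c\<in>S. q c = 1" "\<exists>c\<in>S. q c = -1"
proof -
  have "\<not> (\<forall>c\<in>S. q c = s)" if "s \<noteq> 0" for s
  proof
    assume "\<forall>c\<in>S. q c = s"
    hence "(\<Sum>c\<in>S. q c) = card S * s" by simp
    thus False using sum_q card_pos that by simp
  qed
  from this[of 1] this[of "-1"] show "\<exists>c\<in>S. q c = 1" "\<exists>c\<in>S. q c = -1"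
    using q_cases by fastforce+
qed

lemma abs_signed_lik_less: "\<bar>signed_lik u\<bar> < avg_lik u"
proof -
  obtain c c' where c: "c \<in> S" "q c = 1" "c' \<in> S" "q c' = -1"
    using both_signs by blast
  have "0 < 2 * lik b u / card S" for b
    using lik_pos card_pos by simp
  from this[of c] this[of c'] show ?thesis
    using avg_lik_signed_lik[OF c(1), of u] avg_lik_signed_lik[OF c(3), of u] c by (simp add: abs_less_iff)
qed

lemma avg_lik_pos: "0 < avg_lik u"
  using abs_signed_lik_less[of u] by linarith

lemma abs_ratio_less: "\<bar>signed_lik u / avg_lik u\<bar> < 1"
  using abs_signed_lik_less[of u] avg_lik_pos[of u] by simp

section \<open>Exact Gaussian moments of the likelihoods\<close>

lemma has_integral_exp_affine:
  "has_bochner_integral \<gamma> (\<lambda>u. exp ((2 * (\<Sum>j<N. v j * u j) - b) / N0)) (exp (((\<Sum>j<N. (v j)\<^sup>2) - b) / N0))"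
proof -
  have "exp (- b / N0) * exp (\<Sum>j<N. (2 * v j / N0) * u j) = exp ((2 * (\<Sum>j<N. v j * u j) - b) / N0)" for u
    by (simp add: sum_distrib_left sum_divide_distrib diff_divide_distrib mult_ac flip: exp_add)
  moreover have "exp (- b / N0) * exp (N0 * (\<Sum>j<N. (2 * v j / N0)\<^sup>2) / 4) = exp (((\<Sum>j<N. (v j)\<^sup>2) - b) / N0)"
  proof -
    have "N0 * (\<Sum>j<N. (2 * v j / N0)\<^sup>2) / 4 = (\<Sum>j<N. (v j)\<^sup>2) / N0"
      using N0_pos by (simp add: sum_distrib_left sum_divide_distrib power2_eq_square)
    thus ?thesis by (simp add: diff_divide_distrib flip: exp_add)
  qed
  moreover have "has_bochner_integral \<gamma> (\<lambda>u. exp (- b / N0) * exp (\<Sum>j<N. (2 * v j / N0) * u j))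
      (exp (- b / N0) * exp (N0 * (\<Sum>j<N. (2 * v j / N0)\<^sup>2) / 4))"
    by (intro has_bochner_integral_mult_right gaussian_noise_mgf N0_pos)
  ultimately show ?thesis by simp
qed

lemma has_integral_lik: "has_bochner_integral \<gamma> (lik c) 1"
  using has_integral_exp_affine[of "w c" "\<Sum>j<N. (w c j)\<^sup>2"] by (simp add: lik_def[abs_def])

text \<open>The exponent of the integral is (|w + w'|^2 - |w|^2 - |w'|^2) / N0. The energies cancel
  and only the inner product remains, which is of even order in the amplitude.\<close>

lemma has_integral_lik2: "has_bochner_integral \<gamma> (\<lambda>u. lik c u * lik c' u) (exp (corr c c'))"
proof -
  have "(w c j + w c' j)\<^sup>2 = (w c j)\<^sup>2 + (w c' j)\<^sup>2 + 2 * (w c j * w c' j)" for j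
    by (simp add: power2_eq_square algebra_simps)
  thus ?thesis
    using has_integral_exp_affine[of "\<lambda>j. w c j + w c' j" "(\<Sum>j<N. (w c j)\<^sup>2) + (\<Sum>j<N. (w c' j)\<^sup>2)"]
    by (simp add: lik_def corr_def algebra_simps sum.distrib sum_distrib_left flip: exp_add add_divide_distrib)
qed

lemma has_integral_lik3: "has_bochner_integral \<gamma> (\<lambda>u. lik c u * lik c' u * lik c'' u)
  (exp (corr c c' + corr c c'' + corr c' c''))"
proof -
  have "(w c j + w c' j + w c'' j)\<^sup>2 = (w c j)\<^sup>2 + (w c' j)\<^sup>2 + (w c'' j)\<^sup>2 +
      2 * (w c j * w c' j) + 2 * (w c j * w c'' j) + 2 * (w c' j * w c'' j)" for j
    by (simp add: power2_eq_square algebra_simps)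
  thus ?thesis
    using has_integral_exp_affine[of "\<lambda>j. w c j + w c' j + w c'' j"
        "(\<Sum>j<N. (w c j)\<^sup>2) + (\<Sum>j<N. (w c' j)\<^sup>2) + (\<Sum>j<N. (w c'' j)\<^sup>2)"]
    by (simp add: lik_def corr_def algebra_simps sum.distrib sum_distrib_left
        flip: exp_add add_divide_distrib)
qed

lemma has_integral_avg_lik: "has_bochner_integral \<gamma> avg_lik 1"
proof -
  have "has_bochner_integral \<gamma> (\<lambda>u. (\<Sum>c\<in>S. lik c u) / card S) ((\<Sum>c\<in>S. 1) / card S)"
    by (intro has_bochner_integral_divide has_bochner_integral_sum has_integral_lik)
  thus ?thesis
    using card_pos by (simp add: avg_lik_def[abs_def])
qed

lemma integrable_avg_lik: "integrable \<gamma> avg_lik"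
  and integral_avg_lik: "(\<integral>u. avg_lik u \<partial>\<gamma>) = 1"
  using has_integral_avg_lik by (auto simp: has_bochner_integral_iff)

lemma has_integral_signed_lik_square: "has_bochner_integral \<gamma> (\<lambda>u. (signed_lik u)\<^sup>2)
  ((\<Sum>c\<in>S. \<Sum>c'\<in>S. q c * q c' * exp (corr c c')) / (real (card S))\<^sup>2)"
proof -
  have "(signed_lik u)\<^sup>2 = (\<Sum>c\<in>S. \<Sum>c'\<in>S. q c * q c' * (lik c u * lik c' u)) / (real (card S))\<^sup>2" for u
    by (simp add: signed_lik_def power_divide power2_eq_square sum_product mult_ac)
  moreover have "has_bochner_integral \<gamma>
      (\<lambda>u. (\<Sum>c\<in>S. \<Sum>c'\<in>S. q c * q c' * (lik c u * lik c' u)) / (real (card S))\<^sup>2)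
      ((\<Sum>c\<in>S. \<Sum>c'\<in>S. q c * q c' * exp (corr c c')) / (real (card S))\<^sup>2)"
    by (intro has_bochner_integral_divide has_bochner_integral_sum has_bochner_integral_mult_right has_integral_lik2)
  ultimately show ?thesis by simp
qed

lemma has_integral_signed_lik_square_avg_lik: "has_bochner_integral \<gamma> (\<lambda>u. (signed_lik u)\<^sup>2 * avg_lik u)
  ((\<Sum>c\<in>S. \<Sum>c'\<in>S. \<Sum>c''\<in>S. q c * q c' * exp (corr c c' + corr c c'' + corr c' c'')) / (real (card S)) ^ 3)"
proof -
  have "(signed_lik u)\<^sup>2 * avg_lik u =
      (\<Sum>c\<in>S. \<Sum>c'\<in>S. \<Sum>c''\<in>S. q c * q c' * (lik c u * lik c' u * lik c'' u)) / (real (card S)) ^ 3" for u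
  proof -
    let ?A = "\<Sum>c\<in>S. q c * lik c u" and ?B = "\<Sum>c\<in>S. lik c u"
    have "?A * ?A * ?B = ?A * (?A * ?B)"
      by (rule mult.assoc)
    also have "?A * ?B = (\<Sum>c'\<in>S. \<Sum>c''\<in>S. q c' * lik c' u * lik c'' u)"
      by (rule sum_product)
    also have "?A * \<dots> = (\<Sum>c\<in>S. \<Sum>c'\<in>S. q c * lik c u * (\<Sum>c''\<in>S. q c' * lik c' u * lik c'' u))"
      by (rule sum_product)
    also have "\<dots> = (\<Sum>c\<in>S. \<Sum>c'\<in>S. \<Sum>c''\<in>S. q c * q c' * (lik c u * lik c' u * lik c'' u))"
      by (simp add: sum_distrib_left mult_ac)
    finally have "?A * ?A * ?B = \<dots>" .
    thus ?thesis
      by (simp add: signed_lik_def avg_lik_def power_divide power2_eq_square power3_eq_cube)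
  qed
  moreover have "has_bochner_integral \<gamma>
      (\<lambda>u. (\<Sum>c\<in>S. \<Sum>c'\<in>S. \<Sum>c''\<in>S. q c * q c' * (lik c u * lik c' u * lik c'' u)) / (real (card S)) ^ 3)
      ((\<Sum>c\<in>S. \<Sum>c'\<in>S. \<Sum>c''\<in>S. q c * q c' * exp (corr c c' + corr c c'' + corr c' c'')) / (real (card S)) ^ 3)"
    by (intro has_bochner_integral_divide has_bochner_integral_sum has_bochner_integral_mult_right has_integral_lik3)
  ultimately show ?thesis by simp
qed

text \<open>A factor depending on only one of the two inputs leaves the other sign free to be
  summed, and \<open>sum_q\<close> makes that sum zero.\<close>

lemma sum_sum_q: "(\<Sum>c\<in>S. \<Sum>c'\<in>S. q c * q c' * f c) = 0" "(\<Sum>c\<in>S. \<Sum>c'\<in>S. q c * q c' * f c') = 0"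
proof -
  have "(\<Sum>c\<in>S. \<Sum>c'\<in>S. q c * q c' * f c) = (\<Sum>c\<in>S. q c * f c) * (\<Sum>c\<in>S. q c)"
    unfolding sum_product by (simp add: mult_ac)
  thus "(\<Sum>c\<in>S. \<Sum>c'\<in>S. q c * q c' * f c) = 0" by (simp add: sum_q)
  have "(\<Sum>c\<in>S. \<Sum>c'\<in>S. q c * q c' * f c') = (\<Sum>c\<in>S. q c) * (\<Sum>c\<in>S. q c * f c)"
    unfolding sum_product by (simp add: mult_ac)
  thus "(\<Sum>c\<in>S. \<Sum>c'\<in>S. q c * q c' * f c') = 0" by (simp add: sum_q)
qed

lemma sum_corr: "(\<Sum>c\<in>S. \<Sum>c'\<in>S. q c * q c' * corr c c') = (real (card S))\<^sup>2 * (2 / N0 * (\<Sum>j<N. (mean_shift j)\<^sup>2))"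
proof -
  have "(\<Sum>c\<in>S. \<Sum>c'\<in>S. q c * q c' * corr c c') =
      (\<Sum>c\<in>S. \<Sum>c'\<in>S. \<Sum>j<N. 2 / N0 * ((q c * w c j) * (q c' * w c' j)))"
    by (simp add: corr_def sum_distrib_left sum_divide_distrib mult_ac)
  also have "\<dots> = (\<Sum>c\<in>S. \<Sum>j<N. \<Sum>c'\<in>S. 2 / N0 * ((q c * w c j) * (q c' * w c' j)))"
    by (subst sum.swap) (rule refl)
  also have "\<dots> = (\<Sum>j<N. \<Sum>c\<in>S. \<Sum>c'\<in>S. 2 / N0 * ((q c * w c j) * (q c' * w c' j)))"
    by (rule sum.swap)
  also have "\<dots> = (\<Sum>j<N. 2 / N0 * (\<Sum>c\<in>S. q c * w c j)\<^sup>2)"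
    unfolding power2_eq_square sum_product by (simp only: sum_distrib_left)
  also have "\<dots> = (\<Sum>j<N. 2 / N0 * ((real (card S))\<^sup>2 * (mean_shift j)\<^sup>2))"
    using card_pos by (simp add: mean_shift_def power_divide)
  finally show ?thesis
    by (simp add: sum_distrib_left mult_ac)
qed

text \<open>Of the three correlations only \<open>corr c c'\<close> ties the two signs together. The
  constant and the correlations with the unsigned input \<open>c''\<close> vanish by
  \<open>sum_sum_q\<close>, so the first-order part has the same mean as without the factor
  \<open>avg_lik\<close>.\<close>

lemma sum_corr3: "(\<Sum>c\<in>S. \<Sum>c'\<in>S. \<Sum>c''\<in>S. q c * q c' * (1 + (corr c c' + corr c c'' + corr c' c''))) =
  (real (card S)) ^ 3 * (2 / N0 * (\<Sum>j<N. (mean_shift j)\<^sup>2))"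
proof -
  have "(\<Sum>c''\<in>S. q c * q c' * (1 + (corr c c' + corr c c'' + corr c' c''))) =
      card S * (q c * q c' * corr c c') + q c * q c' * (card S + (\<Sum>c''\<in>S. corr c c'')) +
      q c * q c' * (\<Sum>c''\<in>S. corr c' c'')" for c c'
    by (simp add: sum.distrib sum_distrib_left algebra_simps)
  hence "(\<Sum>c\<in>S. \<Sum>c'\<in>S. \<Sum>c''\<in>S. q c * q c' * (1 + (corr c c' + corr c c'' + corr c' c''))) =
      card S * (\<Sum>c\<in>S. \<Sum>c'\<in>S. q c * q c' * corr c c') +
      (\<Sum>c\<in>S. \<Sum>c'\<in>S. q c * q c' * (card S + (\<Sum>c''\<in>S. corr c c''))) +
      (\<Sum>c\<in>S. \<Sum>c'\<in>S. q c * q c' * (\<Sum>c''\<in>S. corr c' c''))"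
    by (simp add: sum.distrib sum_distrib_left)
  also have "(\<Sum>c\<in>S. \<Sum>c'\<in>S. q c * q c' * (card S + (\<Sum>c''\<in>S. corr c c''))) = 0"
    by (rule sum_sum_q(1))
  also have "(\<Sum>c\<in>S. \<Sum>c'\<in>S. q c * q c' * (\<Sum>c''\<in>S. corr c' c'')) = 0"
    by (rule sum_sum_q(2)[where f = "\<lambda>c'. \<Sum>c''\<in>S. corr c' c''"])
  also have "card S * (\<Sum>c\<in>S. \<Sum>c'\<in>S. q c * q c' * corr c c') + 0 + 0 =
      (real (card S)) ^ 3 * (2 / N0 * (\<Sum>j<N. (mean_shift j)\<^sup>2))"
    unfolding sum_corr by (simp add: eval_nat_numeral)
  finally show ?thesis .
qed

lemma abs_q: "c \<in> S \<Longrightarrow> \<bar>q c\<bar> = 1"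
  using q_cases by fastforce

context
  fixes t :: real
  assumes t_nonneg: "0 \<le> t" and w_bound: "\<And>c. c \<in> S \<Longrightarrow> (\<Sum>j<N. (w c j)\<^sup>2) \<le> N0 * t\<^sup>2 / 2"
begin

text \<open>By the inequality between arithmetic and geometric means. The normalization in
  \<open>w_bound\<close> is chosen to make the bound exactly the square of \<open>t\<close>.\<close>

lemma corr_bound:
  assumes "c \<in> S" "c' \<in> S"
  shows "\<bar>corr c c'\<bar> \<le> t\<^sup>2"
proof -
  have "\<bar>w c j * w c' j\<bar> \<le> ((w c j)\<^sup>2 + (w c' j)\<^sup>2) / 2" for j
    using sum_squares_bound[of "\<bar>w c j\<bar>" "\<bar>w c' j\<bar>"] by (simp add: abs_mult)
  hence "\<bar>\<Sum>j<N. w c j * w c' j\<bar> \<le> (\<Sum>j<N. ((w c j)\<^sup>2 + (w c' j)\<^sup>2) / 2)"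
    by (intro order.trans[OF sum_abs] sum_mono)
  also have "\<dots> = ((\<Sum>j<N. (w c j)\<^sup>2) + (\<Sum>j<N. (w c' j)\<^sup>2)) / 2"
    by (simp add: sum.distrib flip: sum_divide_distrib)
  also have "\<dots> \<le> N0 * t\<^sup>2 / 2"
    using add_mono[OF w_bound[OF assms(1)] w_bound[OF assms(2)]] by simp
  finally show ?thesis
    using N0_pos by (simp add: corr_def abs_mult field_simps)
qed

text \<open>By \<open>sum_corr\<close> the left side is a signed average of correlations. This
  controls the main term when \<open>t\<close> exceeds 1.\<close>

lemma mean_shift_bound: "2 / N0 * (\<Sum>j<N. (mean_shift j)\<^sup>2) \<le> t\<^sup>2"
proof -
  have "(real (card S))\<^sup>2 * (2 / N0 * (\<Sum>j<N. (mean_shift j)\<^sup>2)) \<le> (\<Sum>c\<in>S. \<Sum>c'\<in>S. t\<^sup>2)"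
    unfolding sum_corr[symmetric]
  proof (intro sum_mono)
    fix c c' assume c: "c \<in> S" "c' \<in> S"
    have "\<bar>q c * q c' * corr c c'\<bar> \<le> t\<^sup>2"
      using corr_bound[OF c] abs_q[OF c(1)] abs_q[OF c(2)] by (simp add: abs_mult)
    thus "q c * q c' * corr c c' \<le> t\<^sup>2"
      by (rule abs_le_D1)
  qed
  also have "\<dots> = (real (card S))\<^sup>2 * t\<^sup>2"
    by (simp add: power2_eq_square)
  finally show ?thesis
    by (rule mult_left_le_imp_le) (use card_pos in simp)
qed

text \<open>The third-order terms of \<open>signed_lik\<^sup>2 * (2 - avg_lik)\<close> in the amplitude \<open>t\<close> disappear on
  integration, since the Gaussian integrals depend on \<open>t\<^sup>2\<close> only; \<open>sum_q\<close> removes the remaining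
  unwanted second-order terms.\<close>

lemma integral_signed_lik_square_error:
  assumes "t \<le> 1"
  shows "\<bar>(\<integral>u. (signed_lik u)\<^sup>2 \<partial>\<gamma>) - 2 / N0 * (\<Sum>j<N. (mean_shift j)\<^sup>2)\<bar> \<le> t ^ 4 * exp 3"
proof -
  let ?R = "\<lambda>c c'. exp (corr c c') - 1 - corr c c'"
  have "t\<^sup>2 \<le> 1" using assms t_nonneg by (simp add: power_le_one)
  have R: "\<bar>q c * q c' * ?R c c'\<bar> \<le> t ^ 4 * exp 3" if c: "c \<in> S" "c' \<in> S" for c c'
  proof -
    have "\<bar>?R c c'\<bar> \<le> (t\<^sup>2)\<^sup>2 * exp (t\<^sup>2)"
      by (intro exp_minus_linear_bound corr_bound c)
    \<comment> \<open>\<open>exp 1\<close> would do here; \<open>exp 3\<close> matches the estimate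
      with three correlations.\<close>
    also have "\<dots> \<le> t ^ 4 * exp 3"
      using \<open>t\<^sup>2 \<le> 1\<close> by (intro mult_mono) (auto simp flip: power_mult)
    finally show ?thesis using abs_q c by (simp add: abs_mult)
  qed
  have "(\<Sum>c\<in>S. \<Sum>c'\<in>S. q c * q c' * exp (corr c c')) =
      (\<Sum>c\<in>S. \<Sum>c'\<in>S. q c * q c' * ?R c c') + (\<Sum>c\<in>S. \<Sum>c'\<in>S. q c * q c' * 1) +
      (\<Sum>c\<in>S. \<Sum>c'\<in>S. q c * q c' * corr c c')"
    by (simp add: algebra_simps flip: sum.distrib)
  hence eq: "(\<Sum>c\<in>S. \<Sum>c'\<in>S. q c * q c' * exp (corr c c')) - (real (card S))\<^sup>2 * (2 / N0 * (\<Sum>j<N. (mean_shift j)\<^sup>2)) =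
      (\<Sum>c\<in>S. \<Sum>c'\<in>S. q c * q c' * ?R c c')"
    unfolding sum_sum_q(1)[of "\<lambda>_. 1"] sum_corr by simp
  have "\<bar>\<Sum>c\<in>S. \<Sum>c'\<in>S. q c * q c' * ?R c c'\<bar> \<le> (\<Sum>c\<in>S. \<Sum>c'\<in>S. t ^ 4 * exp 3)"
    by (intro order.trans[OF sum_abs] sum_mono R)
  also have "\<dots> = (real (card S))\<^sup>2 * (t ^ 4 * exp 3)"
    by (simp add: power2_eq_square)
  finally have le: "\<bar>(\<Sum>c\<in>S. \<Sum>c'\<in>S. q c * q c' * exp (corr c c')) -
      (real (card S))\<^sup>2 * (2 / N0 * (\<Sum>j<N. (mean_shift j)\<^sup>2))\<bar> \<le> (real (card S))\<^sup>2 * (t ^ 4 * exp 3)"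
    unfolding eq .
  have "\<bar>x / y - z\<bar> \<le> b" if "\<bar>x - y * z\<bar> \<le> y * b" "0 < y" for x y z b :: real
  proof -
    have "x / y - z = (x - y * z) / y" using that by (simp add: field_simps)
    thus ?thesis using that by (simp add: abs_divide divide_le_eq mult_ac)
  qed
  from this[OF le] show ?thesis
    using card_pos by (simp add: has_bochner_integral_integral_eq[OF has_integral_signed_lik_square])
qed

lemma integral_signed_lik_square_avg_lik_error:
  assumes "t \<le> 1"
  shows "\<bar>(\<integral>u. (signed_lik u)\<^sup>2 * avg_lik u \<partial>\<gamma>) - 2 / N0 * (\<Sum>j<N. (mean_shift j)\<^sup>2)\<bar> \<le> 9 * (t ^ 4 * exp 3)"
proof -
  let ?s = "\<lambda>c c' c''. corr c c' + corr c c'' + corr c' c''"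
  let ?R = "\<lambda>c c' c''. exp (?s c c' c'') - 1 - ?s c c' c''"
  have "t\<^sup>2 \<le> 1" using assms t_nonneg by (simp add: power_le_one)
  have R: "\<bar>q c * q c' * ?R c c' c''\<bar> \<le> 9 * (t ^ 4 * exp 3)" if c: "c \<in> S" "c' \<in> S" "c'' \<in> S" for c c' c''
  proof -
    \<comment> \<open>Three correlations, each bounded by the square of \<open>t\<close>: squaring
      the 3 gives the factor 9, and \<open>t \<le> 1\<close> gives \<open>exp 3\<close>.\<close>
    have "\<bar>?s c c' c''\<bar> \<le> 3 * t\<^sup>2"
      using corr_bound[OF c(1,2)] corr_bound[OF c(1,3)] corr_bound[OF c(2,3)] by linarith
    hence "\<bar>?R c c' c''\<bar> \<le> (3 * t\<^sup>2)\<^sup>2 * exp (3 * t\<^sup>2)"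
      by (rule exp_minus_linear_bound)
    also have "\<dots> \<le> (9 * t ^ 4) * exp 3"
      using \<open>t\<^sup>2 \<le> 1\<close> by (intro mult_mono) (auto simp: power_mult_distrib simp flip: power_mult)
    finally show ?thesis using abs_q c by (simp add: abs_mult)
  qed
  have "(\<Sum>c\<in>S. \<Sum>c'\<in>S. \<Sum>c''\<in>S. q c * q c' * exp (?s c c' c'')) =
      (\<Sum>c\<in>S. \<Sum>c'\<in>S. \<Sum>c''\<in>S. q c * q c' * ?R c c' c'') +
      (\<Sum>c\<in>S. \<Sum>c'\<in>S. \<Sum>c''\<in>S. q c * q c' * (1 + ?s c c' c''))"
    by (simp add: algebra_simps flip: sum.distrib)
  hence eq: "(\<Sum>c\<in>S. \<Sum>c'\<in>S. \<Sum>c''\<in>S. q c * q c' * exp (?s c c' c'')) -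
      (real (card S)) ^ 3 * (2 / N0 * (\<Sum>j<N. (mean_shift j)\<^sup>2)) =
      (\<Sum>c\<in>S. \<Sum>c'\<in>S. \<Sum>c''\<in>S. q c * q c' * ?R c c' c'')"
    unfolding sum_corr3 by simp
  have "\<bar>\<Sum>c\<in>S. \<Sum>c'\<in>S. \<Sum>c''\<in>S. q c * q c' * ?R c c' c''\<bar> \<le> (\<Sum>c\<in>S. \<Sum>c'\<in>S. \<Sum>c''\<in>S. 9 * (t ^ 4 * exp 3))"
    by (intro order.trans[OF sum_abs] sum_mono R)
  also have "\<dots> = (real (card S)) ^ 3 * (9 * (t ^ 4 * exp 3))"
    by (simp add: power3_eq_cube)
  finally have le: "\<bar>(\<Sum>c\<in>S. \<Sum>c'\<in>S. \<Sum>c''\<in>S. q c * q c' * exp (?s c c' c'')) -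
      (real (card S)) ^ 3 * (2 / N0 * (\<Sum>j<N. (mean_shift j)\<^sup>2))\<bar> \<le> (real (card S)) ^ 3 * (9 * (t ^ 4 * exp 3))"
    unfolding eq .
  have "\<bar>x / y - z\<bar> \<le> b" if "\<bar>x - y * z\<bar> \<le> y * b" "0 < y" for x y z b :: real
  proof -
    have "x / y - z = (x - y * z) / y" using that by (simp add: field_simps)
    thus ?thesis using that by (simp add: abs_divide divide_le_eq mult_ac)
  qed
  from this[OF le] show ?thesis
    using card_pos by (simp add: has_bochner_integral_integral_eq[OF has_integral_signed_lik_square_avg_lik])
qed

text \<open>The factor \<open>sqrt (2 / N0)\<close> measures the noise in units of its standard
  deviation. The cross term is linear in \<open>t\<close>, and \<open>t \<le> 1\<close> lets the
  quadratic energy term be absorbed into a linear one.\<close>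

lemma lik_exponent_bound:
  assumes "t \<le> 1" "c \<in> S"
  shows "\<bar>(2 * (\<Sum>j<N. w c j * u j) - (\<Sum>j<N. (w c j)\<^sup>2)) / N0\<bar> \<le> t * (1 + sqrt (2 / N0) * (\<Sum>j<N. \<bar>u j\<bar>))"
proof -
  define l where "l = sqrt (2 / N0)"
  have l: "N0 * l\<^sup>2 = 2" "0 < l"
    using N0_pos by (auto simp: l_def)
  have w: "\<bar>w c j\<bar> \<le> N0 * t * l / 2" if "j < N" for j
  proof (rule power2_le_imp_le)
    have "(w c j)\<^sup>2 \<le> (\<Sum>j<N. (w c j)\<^sup>2)"
      using that by (intro member_le_sum) auto
    also have "\<dots> \<le> N0 * t\<^sup>2 / 2"
      by (rule w_bound[OF assms(2)])
    also have "\<dots> = (N0 * t * l / 2)\<^sup>2"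
    proof -
      have "(N0 * t * l / 2)\<^sup>2 = N0 * t\<^sup>2 * (N0 * l\<^sup>2) / 4"
        by (simp add: power2_eq_square)
      thus ?thesis unfolding l(1) by simp
    qed
    finally show "\<bar>w c j\<bar>\<^sup>2 \<le> (N0 * t * l / 2)\<^sup>2" by simp
  qed (use N0_pos t_nonneg l in auto)
  have "\<bar>w c j * u j\<bar> \<le> (N0 * t * l / 2) * \<bar>u j\<bar>" if "j < N" for j
    unfolding abs_mult by (intro mult_right_mono w that) simp
  hence "\<bar>\<Sum>j<N. w c j * u j\<bar> \<le> (\<Sum>j<N. (N0 * t * l / 2) * \<bar>u j\<bar>)"
    by (intro order.trans[OF sum_abs] sum_mono) simp
  also have "\<dots> = (N0 * t * l / 2) * (\<Sum>j<N. \<bar>u j\<bar>)"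
    by (rule sum_distrib_left[symmetric])
  finally have 1: "\<bar>\<Sum>j<N. w c j * u j\<bar> \<le> N0 * (t * l * (\<Sum>j<N. \<bar>u j\<bar>)) / 2"
    by (simp add: mult_ac)
  have "t\<^sup>2 \<le> t"
    using assms(1) t_nonneg by (simp add: power2_eq_square mult_left_le)
  hence "N0 * t\<^sup>2 / 2 \<le> N0 * t"
    using N0_pos t_nonneg mult_left_mono[of "t\<^sup>2" t N0] by (auto intro: order.trans[rotated])
  hence 2: "\<bar>\<Sum>j<N. (w c j)\<^sup>2\<bar> \<le> N0 * t"
    using w_bound[OF assms(2)] by (auto simp: sum_nonneg)
  have "\<bar>2 * (\<Sum>j<N. w c j * u j) - (\<Sum>j<N. (w c j)\<^sup>2)\<bar> \<le> N0 * (t * l * (\<Sum>j<N. \<bar>u j\<bar>)) + N0 * t"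
    using 1 2 by linarith
  also have "\<dots> = (t * (1 + l * (\<Sum>j<N. \<bar>u j\<bar>))) * N0"
    by (simp add: algebra_simps)
  finally show ?thesis
    using N0_pos by (simp only: l_def abs_divide pos_divide_le_eq abs_of_pos)
qed

text \<open>With T = t (1 + G), the factor (1 + G)^4 of T^4 is at most
  \<open>24 * exp (1 + G)\<close>, and \<open>exp (7 * T)\<close> is at most
  \<open>exp (7 * (1 + G))\<close>. Together they give 24, \<open>exp 8\<close> and the rate 8,
  while \<open>t ^ 4\<close> stays in front.\<close>

lemma info_density_expansion:
  assumes "t \<le> 1"
  shows "\<bar>info_density u - (signed_lik u)\<^sup>2 * (2 - avg_lik u) / 2\<bar> \<le>
    17 * 24 * exp 8 * t ^ 4 * (\<Prod>j<N. exp (8 * sqrt (2 / N0) * u j) + exp (- (8 * sqrt (2 / N0)) * u j))"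
proof -
  define G where "G = sqrt (2 / N0) * (\<Sum>j<N. \<bar>u j\<bar>)"
  define T where "T = t * (1 + G)"
  have "0 \<le> G"
    using N0_pos by (simp add: G_def sum_nonneg)
  hence "0 \<le> T" "T \<le> 1 + G"
    using t_nonneg assms by (auto simp: T_def intro!: mult_left_le_one_le)
  have a: "\<bar>(2 * (\<Sum>j<N. w c j * u j) - (\<Sum>j<N. (w c j)\<^sup>2)) / N0\<bar> \<le> T" if "c \<in> S" for c
    using lik_exponent_bound[OF assms that, of u] by (simp add: T_def G_def)
  have l1: "\<bar>lik c u - 1\<bar> \<le> T * exp T" if "c \<in> S" for c
    unfolding lik_def by (rule exp_minus_one_bound[OF a[OF that]])
  have l2: "exp (- T) \<le> lik c u" if "c \<in> S" for c
    unfolding lik_def exp_le_cancel_iff using a[OF that] by linarith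
  have avg: "\<bar>(\<Sum>c\<in>S. f c) / card S\<bar> \<le> b" if "\<And>c. c \<in> S \<Longrightarrow> \<bar>f c\<bar> \<le> b" for f b
  proof -
    have "\<bar>\<Sum>c\<in>S. f c\<bar> \<le> (\<Sum>c\<in>S. b)"
      using that by (intro order.trans[OF sum_abs] sum_mono)
    thus ?thesis using card_pos by (simp add: divide_le_eq mult_ac)
  qed
  \<comment> \<open>Since the signs sum to zero, 1 may be subtracted from each likelihood; this is
    why \<open>signed_lik\<close> is small and not merely bounded.\<close>
  have "(\<Sum>c\<in>S. q c * (lik c u - 1)) = (\<Sum>c\<in>S. q c * lik c u)"
    by (simp add: algebra_simps sum_subtractf sum_q)
  hence D: "\<bar>signed_lik u\<bar> \<le> T * exp T"
    using avg[of "\<lambda>c. q c * (lik c u - 1)" "T * exp T"] l1 abs_q by (simp add: signed_lik_def abs_mult)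
  have "avg_lik u - 1 = (\<Sum>c\<in>S. lik c u - 1) / card S"
    using card_pos by (simp add: avg_lik_def sum_subtractf diff_divide_distrib)
  hence P: "\<bar>avg_lik u - 1\<bar> \<le> T * exp T"
    using avg[of "\<lambda>c. lik c u - 1" "T * exp T"] l1 by simp
  have "(\<Sum>c\<in>S. exp (- T)) \<le> (\<Sum>c\<in>S. lik c u)"
    by (intro sum_mono l2)
  hence P': "exp (- T) \<le> avg_lik u"
    using card_pos by (simp add: avg_lik_def le_divide_eq mult_ac)
  have "\<bar>info_density u - (signed_lik u)\<^sup>2 * (2 - avg_lik u) / 2\<bar> \<le> 17 * (T ^ 4 * exp (7 * T))"
    unfolding info_density_def by (rule bit_divergence_expansion[OF abs_signed_lik_less D P P'])
  also have "T ^ 4 * exp (7 * T) \<le> (t ^ 4 * (24 * exp (1 + G))) * exp (7 * (1 + G))"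
  proof (rule mult_mono)
    show "T ^ 4 \<le> t ^ 4 * (24 * exp (1 + G))"
      unfolding T_def power_mult_distrib using \<open>0 \<le> G\<close> t_nonneg
      by (intro mult_left_mono fourth_power_le_exp) auto
  qed (use \<open>T \<le> 1 + G\<close> in auto)
  also have "\<dots> = 24 * exp 8 * t ^ 4 * exp (8 * sqrt (2 / N0) * (\<Sum>j<N. \<bar>u j\<bar>))"
    by (simp add: G_def algebra_simps flip: exp_add)
  also have "\<dots> \<le> 24 * exp 8 * t ^ 4 * (\<Prod>j<N. exp (8 * sqrt (2 / N0) * u j) + exp (- (8 * sqrt (2 / N0)) * u j))"
    using N0_pos by (intro mult_left_mono exp_sum_abs_le) auto
  finally show ?thesis by (simp add: mult_ac)
qed

end

lemma info_density_bounds: "0 \<le> info_density u" "info_density u \<le> avg_lik u"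
  using bit_divergence_quadratic(2)[OF abs_ratio_less] bit_divergence_le[OF abs_ratio_less] avg_lik_pos[of u]
  by (auto simp: info_density_def intro!: mult_left_le)

lemma integrable_info_density: "integrable \<gamma> info_density"
  using info_density_bounds
  by (intro Bochner_Integration.integrable_bound[OF integrable_avg_lik])
     (auto simp: avg_lik_pos[THEN less_imp_le])

lemma integral_info_density_bounds: "0 \<le> (\<integral>u. info_density u \<partial>\<gamma>)" "(\<integral>u. info_density u \<partial>\<gamma>) \<le> 1"
proof -
  show "0 \<le> (\<integral>u. info_density u \<partial>\<gamma>)"
    by (intro Bochner_Integration.integral_nonneg info_density_bounds)
  have "(\<integral>u. info_density u \<partial>\<gamma>) \<le> (\<integral>u. avg_lik u \<partial>\<gamma>)"
    by (intro integral_mono integrable_info_density integrable_avg_lik info_density_bounds)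
  thus "(\<integral>u. info_density u \<partial>\<gamma>) \<le> 1"
    by (simp add: integral_avg_lik)
qed

text \<open>The constant depends on N alone, so the estimate can later be averaged over the fading
  with \<open>t\<close> depending on h.\<close>

lemma integral_info_density_expansion:
  assumes "0 \<le> t" "\<And>c. c \<in> S \<Longrightarrow> (\<Sum>j<N. (w c j)\<^sup>2) \<le> N0 * t\<^sup>2 / 2"
  shows "\<bar>(\<integral>u. info_density u \<partial>\<gamma>) - (\<Sum>j<N. (mean_shift j)\<^sup>2) / N0\<bar> \<le>
    (17 * 24 * exp 8 * (2 * exp 32) ^ N + 6 * exp 3) * t ^ 4"
proof (cases "t \<le> 1")
  case True
  define l where "l = 8 * sqrt (2 / N0)"
  let ?A = "2 / N0 * (\<Sum>j<N. (mean_shift j)\<^sup>2)"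
  let ?Q = "\<lambda>u. (signed_lik u)\<^sup>2 * (2 - avg_lik u) / 2"
  let ?E = "\<lambda>u. \<Prod>j<N. exp (l * u j) + exp (- l * u j)"
  \<comment> \<open>64 * 2 / 4: the noise level cancels against the normalization of the rate
    \<open>l\<close>.\<close>
  have "N0 * l\<^sup>2 / 4 = 32"
    using N0_pos by (simp add: l_def power_mult_distrib)
  moreover have "0 \<le> l" using N0_pos by (simp add: l_def)
  ultimately have E: "has_bochner_integral \<gamma> ?E ((2 * exp 32) ^ N)"
    using gaussian_noise_exp_abs[OF N0_pos, of l N] by metis
  have Q_eq: "?Q = (\<lambda>u. (signed_lik u)\<^sup>2 - ((signed_lik u)\<^sup>2 * avg_lik u) / 2)"
    by (auto simp: field_simps)
  have Q: "has_bochner_integral \<gamma> ?Q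
      ((\<integral>u. (signed_lik u)\<^sup>2 \<partial>\<gamma>) - (\<integral>u. (signed_lik u)\<^sup>2 * avg_lik u \<partial>\<gamma>) / 2)"
    unfolding Q_eq using has_integral_signed_lik_square has_integral_signed_lik_square_avg_lik
    by (intro has_bochner_integral_diff has_bochner_integral_divide) (auto simp: has_bochner_integral_iff)
  have "\<bar>(\<integral>u. info_density u \<partial>\<gamma>) - (\<integral>u. ?Q u \<partial>\<gamma>)\<bar> = \<bar>\<integral>u. info_density u - ?Q u \<partial>\<gamma>\<bar>"
    using integrable_info_density Q by (simp add: has_bochner_integral_iff)
  also have "\<dots> \<le> (\<integral>u. \<bar>info_density u - ?Q u\<bar> \<partial>\<gamma>)"
    by (rule integral_abs_bound)
  also have "\<dots> \<le> (\<integral>u. 17 * 24 * exp 8 * t ^ 4 * ?E u \<partial>\<gamma>)"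
    using integrable_info_density Q E info_density_expansion[OF assms True, folded l_def]
    by (intro integral_mono integrable_abs Bochner_Integration.integrable_diff integrable_mult_right)
       (auto simp: has_bochner_integral_iff)
  also have "\<dots> = 17 * 24 * exp 8 * t ^ 4 * (2 * exp 32) ^ N"
    using E by (simp add: has_bochner_integral_iff)
  finally have 1: "\<bar>(\<integral>u. info_density u \<partial>\<gamma>) - (\<integral>u. ?Q u \<partial>\<gamma>)\<bar> \<le> 17 * 24 * exp 8 * t ^ 4 * (2 * exp 32) ^ N" .
  have 2: "\<bar>(\<integral>u. ?Q u \<partial>\<gamma>) - ?A / 2\<bar> \<le> 6 * (t ^ 4 * exp 3)"
    unfolding has_bochner_integral_integral_eq[OF Q]
  proof -
    \<comment> \<open>Both integrals have the main term \<open>?A\<close>, so their combination has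
      \<open>?A / 2\<close>; the errors add up to 1 + 9/2, rounded up to 6.\<close>
    have "\<bar>a - b / 2 - c / 2\<bar> \<le> 6 * e" if "\<bar>a - c\<bar> \<le> e" "\<bar>b - c\<bar> \<le> 9 * e" for a b c e :: real
      using that by linarith
    from this[OF integral_signed_lik_square_error[OF assms True] integral_signed_lik_square_avg_lik_error[OF assms True]]
    show "\<bar>(\<integral>u. (signed_lik u)\<^sup>2 \<partial>\<gamma>) - (\<integral>u. (signed_lik u)\<^sup>2 * avg_lik u \<partial>\<gamma>) / 2 - ?A / 2\<bar> \<le> 6 * (t ^ 4 * exp 3)" .
  qed
  have "?A / 2 = (\<Sum>j<N. (mean_shift j)\<^sup>2) / N0" by simp
  thus ?thesis
    using 1 2 by (simp add: algebra_simps)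
next
  case False
  have "1 \<le> t\<^sup>2" using False by simp
  hence "t\<^sup>2 \<le> t ^ 4" "1 \<le> t ^ 4"
    using mult_left_mono[of 1 "t\<^sup>2" "t\<^sup>2"] by (auto simp flip: power_add)
  have "0 \<le> 2 / N0 * (\<Sum>j<N. (mean_shift j)\<^sup>2)"
    using N0_pos by (simp add: sum_nonneg)
  hence "0 \<le> (\<Sum>j<N. (mean_shift j)\<^sup>2) / N0" "(\<Sum>j<N. (mean_shift j)\<^sup>2) / N0 \<le> t\<^sup>2"
    using mean_shift_bound[OF assms] by auto
  hence "\<bar>(\<integral>u. info_density u \<partial>\<gamma>) - (\<Sum>j<N. (mean_shift j)\<^sup>2) / N0\<bar> \<le> 1 * t ^ 4"
    using integral_info_density_bounds \<open>t\<^sup>2 \<le> t ^ 4\<close> \<open>1 \<le> t ^ 4\<close> by linarith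
  also have "\<dots> \<le> (17 * 24 * exp 8 * (2 * exp 32) ^ N + 6 * exp 3) * t ^ 4"
  proof (rule mult_right_mono)
    have "(1::real) \<le> 6 * exp 3" using one_le_exp_iff[of "3::real"] by linarith
    thus "1 \<le> 17 * 24 * exp 8 * (2 * exp 32) ^ N + 6 * exp (3::real)"
      by (simp add: add_increasing)
  qed simp
  finally show ?thesis .
qed

text \<open>The posterior probability of the sign of \<open>c\<close> is half the argument of
  \<open>ln\<close>, and its prior is 1/2, so this is the logarithm of posterior over prior.\<close>

definition log_ratio :: "'c \<Rightarrow> (nat \<Rightarrow> real) \<Rightarrow> real" where
  "log_ratio c u = ln (1 + q c * (signed_lik u / avg_lik u))"

lemma measurable_log_ratio [measurable]: "log_ratio c \<in> borel_measurable \<gamma>"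
  unfolding log_ratio_def[abs_def] by measurable

text \<open>Dominates the integrands although \<open>log_ratio\<close> is unbounded below: the likelihood of \<open>c\<close> is at
  most a constant times \<open>x * avg_lik u\<close>, where \<open>log_ratio c u = ln x\<close> and \<open>x * ln x\<close> is bounded.\<close>

lemma lik_log_ratio_bound:
  assumes "c \<in> S"
  shows "\<bar>lik c u * log_ratio c u\<bar> \<le> 2 * card S * avg_lik u"
proof -
  let ?x = "1 + q c * (signed_lik u / avg_lik u)"
  have "0 < 1 + q c * d \<and> 1 + q c * d \<le> 2" if "\<bar>d\<bar> < 1" for d
    using that q_cases[OF assms] by auto
  from this[OF abs_ratio_less] have x: "0 < ?x" "?x \<le> 2" by blast+
  have "lik c u \<le> 2 * lik c u"
    using lik_pos[of c u] by simp
  also have "\<dots> \<le> card S * (avg_lik u + q c * signed_lik u)"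
    using avg_lik_signed_lik[OF assms, of u] card_pos by (simp add: divide_le_eq mult_ac)
  also have "\<dots> = card S * avg_lik u * ?x"
    using avg_lik_pos[of u] by (simp add: field_simps)
  finally have "\<bar>lik c u * log_ratio c u\<bar> \<le> (card S * avg_lik u * ?x) * \<bar>ln ?x\<bar>"
    using lik_pos[of c u] by (simp add: abs_mult log_ratio_def mult_right_mono)
  also have "\<dots> = card S * avg_lik u * \<bar>?x * ln ?x\<bar>"
    using x by (simp only: abs_mult abs_of_pos mult.assoc)
  also have "\<dots> \<le> card S * avg_lik u * 2"
    using abs_mult_ln_le[OF x] avg_lik_pos[of u] by (intro mult_left_mono) auto
  finally show ?thesis by (simp add: mult_ac)
qed

text \<open>Only two logarithms occur, one for each sign. Collecting the inputs by sign gives them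
  the weights P (1 + d) / 2 and P (1 - d) / 2 with P = \<open>avg_lik u\<close>, which is the
  divergence times P.\<close>

lemma sum_lik_log_ratio: "(\<Sum>c\<in>S. lik c u * log_ratio c u) / card S = info_density u"
proof -
  define d where "d = signed_lik u / avg_lik u"
  define a b where "a = ln (1 + d)" and "b = ln (1 - d)"
  have "lik c u * log_ratio c u = (lik c u + q c * lik c u) / 2 * a + (lik c u - q c * lik c u) / 2 * b"
    if "c \<in> S" for c
    using q_cases[OF that] by (auto simp: log_ratio_def a_def b_def d_def)
  hence "(\<Sum>c\<in>S. lik c u * log_ratio c u) =
      (\<Sum>c\<in>S. (lik c u + q c * lik c u) / 2 * a + (lik c u - q c * lik c u) / 2 * b)"
    by (rule sum.cong[OF refl])
  also have "\<dots> = ((\<Sum>c\<in>S. lik c u) + (\<Sum>c\<in>S. q c * lik c u)) / 2 * a +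
      ((\<Sum>c\<in>S. lik c u) - (\<Sum>c\<in>S. q c * lik c u)) / 2 * b"
    by (simp only: sum.distrib sum_subtractf flip: sum_divide_distrib sum_distrib_right)
  finally have sum_eq: "(\<Sum>c\<in>S. lik c u * log_ratio c u) = \<dots>" .
  have "(\<Sum>c\<in>S. lik c u * log_ratio c u) / card S =
      (avg_lik u + signed_lik u) / 2 * a + (avg_lik u - signed_lik u) / 2 * b"
    unfolding sum_eq
    by (simp add: avg_lik_def signed_lik_def add_divide_distrib diff_divide_distrib algebra_simps)
  also have "signed_lik u = avg_lik u * d"
    using avg_lik_pos[of u] by (simp add: d_def)
  also have "(avg_lik u + avg_lik u * d) / 2 * a + (avg_lik u - avg_lik u * d) / 2 * b = info_density u"
    unfolding info_density_def bit_divergence_def d_def[symmetric] a_def[symmetric] b_def[symmetric]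
    by (simp add: field_simps)
  finally show ?thesis .
qed

lemma integrable_lik_log_ratio:
  assumes "c \<in> S"
  shows "integrable \<gamma> (\<lambda>u. lik c u * log_ratio c u)"
  using lik_log_ratio_bound[OF assms] avg_lik_pos[THEN less_imp_le]
  by (intro Bochner_Integration.integrable_bound[OF integrable_mult_right[of "2 * card S", OF integrable_avg_lik]])
     (auto simp: abs_mult)

lemma integral_abs_lik_log_ratio:
  assumes "c \<in> S"
  shows "(\<integral>u. \<bar>lik c u * log_ratio c u\<bar> \<partial>\<gamma>) \<le> 2 * card S"
proof -
  have "(\<integral>u. \<bar>lik c u * log_ratio c u\<bar> \<partial>\<gamma>) \<le> (\<integral>u. 2 * card S * avg_lik u \<partial>\<gamma>)"
    by (intro integral_mono integrable_abs integrable_lik_log_ratio lik_log_ratio_bound assms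
        integrable_mult_right integrable_avg_lik)
  thus ?thesis
    by (simp add: integral_avg_lik)
qed

text \<open>Moves expectations over the output of any input to the common reference law \<gamma>.
  The equivalence carries integrability from the dominated weighted integrand back to the shifted
  noise.\<close>

lemma shifted_noise:
  assumes [measurable]: "g \<in> borel_measurable (PiM {..<N} (\<lambda>_. borel))"
  shows "(\<integral>z. g (\<lambda>j\<in>{..<N}. w c j + z j) \<partial>\<gamma>) = (\<integral>u. lik c u * g u \<partial>\<gamma>)"
    and "integrable \<gamma> (\<lambda>z. g (\<lambda>j\<in>{..<N}. w c j + z j)) \<longleftrightarrow> integrable \<gamma> (\<lambda>u. lik c u * g u)"
proof -
  let ?T = "\<lambda>z. \<lambda>j\<in>{..<N}. w c j + z j"
  have eq: "distr \<gamma> (PiM {..<N} (\<lambda>_. borel)) ?T = density \<gamma> (\<lambda>u. ennreal (lik c u))"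
    unfolding lik_def by (rule gaussian_noise_shift[OF N0_pos])
  have g: "g \<in> borel_measurable \<gamma>" by measurable
  have "(\<integral>z. g (?T z) \<partial>\<gamma>) = (\<integral>u. g u \<partial>distr \<gamma> (PiM {..<N} (\<lambda>_. borel)) ?T)"
    by (subst integral_distr) auto
  also have "\<dots> = (\<integral>u. lik c u * g u \<partial>\<gamma>)"
    unfolding eq using g lik_pos[THEN less_imp_le] by (subst integral_density) auto
  finally show "(\<integral>z. g (?T z) \<partial>\<gamma>) = (\<integral>u. lik c u * g u \<partial>\<gamma>)" .
  have "integrable \<gamma> (\<lambda>z. g (?T z)) \<longleftrightarrow> integrable (distr \<gamma> (PiM {..<N} (\<lambda>_. borel)) ?T) g"
    by (subst integrable_distr_eq) auto
  also have "\<dots> \<longleftrightarrow> integrable \<gamma> (\<lambda>u. lik c u * g u)"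
    unfolding eq using g lik_pos[THEN less_imp_le] by (subst integrable_density) auto
  finally show "integrable \<gamma> (\<lambda>z. g (?T z)) \<longleftrightarrow> integrable \<gamma> (\<lambda>u. lik c u * g u)" .
qed

lemma log_ratio_shifted:
  assumes "c \<in> S"
  shows "integrable \<gamma> (\<lambda>z. log_ratio c (\<lambda>j\<in>{..<N}. w c j + z j))"
    and "(\<integral>z. \<bar>log_ratio c (\<lambda>j\<in>{..<N}. w c j + z j)\<bar> \<partial>\<gamma>) \<le> 2 * card S"
proof -
  have m [measurable]: "log_ratio c \<in> borel_measurable (PiM {..<N} (\<lambda>_. borel))"
    using measurable_log_ratio[of c] by (simp cong: measurable_cong_sets)
  show "integrable \<gamma> (\<lambda>z. log_ratio c (\<lambda>j\<in>{..<N}. w c j + z j))"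
    using integrable_lik_log_ratio[OF assms] by (simp add: shifted_noise(2)[OF m])
  have "(\<integral>z. \<bar>log_ratio c (\<lambda>j\<in>{..<N}. w c j + z j)\<bar> \<partial>\<gamma>) = (\<integral>u. lik c u * \<bar>log_ratio c u\<bar> \<partial>\<gamma>)"
    by (rule shifted_noise(1)) measurable
  thus "(\<integral>z. \<bar>log_ratio c (\<lambda>j\<in>{..<N}. w c j + z j)\<bar> \<partial>\<gamma>) \<le> 2 * card S"
    using integral_abs_lik_log_ratio[OF assms] lik_pos[THEN less_imp_le] by (simp add: abs_mult)
qed

lemma avg_integral_log_ratio:
  "(\<Sum>c\<in>S. \<integral>z. log_ratio c (\<lambda>j\<in>{..<N}. w c j + z j) \<partial>\<gamma>) / card S = (\<integral>u. info_density u \<partial>\<gamma>)"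
proof -
  have m: "log_ratio c \<in> borel_measurable (PiM {..<N} (\<lambda>_. borel))" for c
    using measurable_log_ratio[of c] by (simp cong: measurable_cong_sets)
  have "(\<Sum>c\<in>S. \<integral>z. log_ratio c (\<lambda>j\<in>{..<N}. w c j + z j) \<partial>\<gamma>) = (\<integral>u. (\<Sum>c\<in>S. lik c u * log_ratio c u) \<partial>\<gamma>)"
    using integrable_lik_log_ratio by (simp add: shifted_noise(1)[OF m] Bochner_Integration.integral_sum)
  thus ?thesis
    by (simp flip: sum_lik_log_ratio)
qed

end

section \<open>Uniform bits and the densities of the channel\<close>

definition bit_vectors :: "nat \<Rightarrow> (nat \<Rightarrow> nat) set" where
  "bit_vectors m = PiE_dflt {..<m} 0 (\<lambda>_. {0, 1})"

text \<open>The sign convention of \<open>modified_labeling\<close>, without its reversal of the bit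
  positions.\<close>

definition bit_sign :: "nat \<Rightarrow> (nat \<Rightarrow> nat) \<Rightarrow> real" where
  "bit_sign k c = (if c k = 1 then - 1 else 1)"

lemma finite_bit_vectors [simp]: "finite (bit_vectors m)"
  unfolding bit_vectors_def by (rule finite_PiE_dflt) auto

lemma card_bit_vectors: "card (bit_vectors m) = 2 ^ m"
  unfolding bit_vectors_def by (subst card_PiE_dflt) (auto simp: numeral_2_eq_2)

lemma bit_vectors_nonempty [simp]: "bit_vectors m \<noteq> {}"
  using card_bit_vectors[of m] by auto

lemma uniform_bits_eq: "uniform_bits m = pmf_of_set (bit_vectors m)"
  unfolding uniform_bits_def bit_vectors_def by (rule Pi_pmf_of_set) auto

lemma bit_sign_cases: "bit_sign k c = 1 \<or> bit_sign k c = - 1"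
  by (simp add: bit_sign_def)

lemma bit_sign_square: "bit_sign k c * bit_sign k c = 1"
  by (simp add: bit_sign_def)

lemma bit_vectors_cases: "c \<in> bit_vectors m \<Longrightarrow> k < m \<Longrightarrow> c k = 0 \<or> c k = 1"
  by (auto simp: bit_vectors_def PiE_dflt_def)

text \<open>Flipping bit \<open>k\<close> permutes the bit vectors and negates \<open>bit_sign k\<close>.\<close>

lemma sum_bit_sign_mult:
  assumes k: "k < m" and f: "\<And>c b. c \<in> bit_vectors m \<Longrightarrow> f (c(k := b)) = f c"
  shows "(\<Sum>c\<in>bit_vectors m. bit_sign k c * f c) = 0"
proof -
  let ?flip = "\<lambda>c. c(k := 1 - c k)"
  have "(\<Sum>c\<in>bit_vectors m. bit_sign k c * f c) = (\<Sum>c\<in>bit_vectors m. - (bit_sign k c * f c))"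
  proof (rule sum.reindex_bij_witness[of _ ?flip ?flip])
    fix c assume c: "c \<in> bit_vectors m"
    show "?flip (?flip c) = c"
      using bit_vectors_cases[OF c k] by (auto simp: fun_eq_iff)
    thus "?flip (?flip c) = c" .
    show "?flip c \<in> bit_vectors m"
      using c k by (auto simp: bit_vectors_def PiE_dflt_def)
    thus "?flip c \<in> bit_vectors m" .
    show "- (bit_sign k (?flip c) * f (?flip c)) = bit_sign k c * f c"
      using bit_vectors_cases[OF c k] f[OF c, of "1 - c k"] by (auto simp: bit_sign_def)
  qed
  thus ?thesis by (simp add: sum_negf)
qed

lemma sum_bit_sign: "k < m \<Longrightarrow> (\<Sum>c\<in>bit_vectors m. bit_sign k c) = 0"
  using sum_bit_sign_mult[of k m "\<lambda>_. 1"] by simp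

lemma sum_bit_sign_orthogonal:
  assumes "k < m" "l < m"
  shows "(\<Sum>c\<in>bit_vectors m. bit_sign k c * bit_sign l c) = (if k = l then 2 ^ m else 0)"
proof (cases "k = l")
  case True
  thus ?thesis by (simp add: bit_sign_square card_bit_vectors)
next
  case False
  thus ?thesis
    using sum_bit_sign_mult[OF assms(1), of "bit_sign l"] by (auto simp: bit_sign_def)
qed

lemma binary_input_bits:
  assumes "k < m" "0 < N0"
  shows "binary_input (bit_vectors m) (bit_sign k) N0"
  using assms bit_sign_cases sum_bit_sign by unfold_locales auto

section \<open>Channel densities as multiples of likelihoods\<close>

lemma dens_given_symbol_eq:
  assumes "0 < N0"
  shows "dens_given_symbol N N0 x h y =
    (\<Prod>j<N. normal_density 0 (sqrt (N0 / 2)) (y j)) *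
    exp ((2 * (\<Sum>j<N. h j * x $ j * y j) - (\<Sum>j<N. (h j * x $ j)\<^sup>2)) / N0)"
proof -
  have "dens_given_symbol N N0 x h y = (\<Prod>j<N. normal_density 0 (sqrt (N0 / 2)) (y j) *
      exp ((2 * (h j * x $ j) * y j - (h j * x $ j)\<^sup>2) / N0))"
    unfolding dens_given_symbol_def
    by (intro prod.cong refl) (simp only: normal_density_tilt[OF assms, of "h _ * x $ _"])
  also have "\<dots> = (\<Prod>j<N. normal_density 0 (sqrt (N0 / 2)) (y j)) *
      exp (\<Sum>j<N. (2 * (h j * x $ j) * y j - (h j * x $ j)\<^sup>2) / N0)"
    by (simp add: prod.distrib exp_sum)
  also have "(\<Sum>j<N. (2 * (h j * x $ j) * y j - (h j * x $ j)\<^sup>2) / N0) =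
      (2 * (\<Sum>j<N. h j * x $ j * y j) - (\<Sum>j<N. (h j * x $ j)\<^sup>2)) / N0"
    by (simp add: sum_subtractf sum_distrib_left mult_ac flip: sum_divide_distrib)
  finally show ?thesis .
qed

text \<open>The weight is 2 where the bits agree and 0 where they differ, so conditioning on a bit
  becomes a signed sum over all bit vectors.\<close>

lemma sum_bit_fibre:
  assumes "c \<in> bit_vectors m" "k < m"
  shows "(\<Sum>c'\<in>bit_vectors m. (1 + bit_sign k c * bit_sign k c') * f c') =
    2 * (\<Sum>c'\<in>bit_vectors m \<inter> {c'. c' k = c k}. f c')"
proof -
  have "(\<Sum>c'\<in>bit_vectors m. (1 + bit_sign k c * bit_sign k c') * f c') =
      (\<Sum>c'\<in>bit_vectors m. if c' k = c k then 2 * f c' else 0)"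
  proof (intro sum.cong refl)
    fix c' assume "c' \<in> bit_vectors m"
    from bit_vectors_cases[OF this assms(2)] bit_vectors_cases[OF assms]
    show "(1 + bit_sign k c * bit_sign k c') * f c' = (if c' k = c k then 2 * f c' else 0)"
      by (auto simp: bit_sign_def)
  qed
  also have "\<dots> = (\<Sum>c'\<in>bit_vectors m \<inter> {c'. c' k = c k}. 2 * f c')"
    by (simp add: sum.inter_restrict)
  finally show ?thesis
    by (simp add: sum_distrib_left)
qed

lemma dens_eq:
  "dens X L N0 h y = (\<Sum>c\<in>bit_vectors (dim_col L).
     dens_given_symbol (dim_col X) N0 (symbol X L c) h y) / 2 ^ dim_col L"
  by (simp add: dens_def uniform_bits_eq integral_pmf_of_set card_bit_vectors)

lemma dens_given_bit_eq:
  assumes "c \<in> bit_vectors (dim_col L)" "k < dim_col L"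
  shows "dens_given_bit X L N0 k (c k) h y = (\<Sum>c'\<in>bit_vectors (dim_col L).
    (1 + bit_sign k c * bit_sign k c') * dens_given_symbol (dim_col X) N0 (symbol X L c') h y) / 2 ^ dim_col L"
proof -
  let ?B = "bit_vectors (dim_col L)" and ?s = "{c'. c' k = c k}"
  have "c \<in> ?B \<inter> ?s" using assms by auto
  hence ne: "?B \<inter> ?s \<noteq> {}" by blast
  have "2 * real (card (?B \<inter> ?s)) = (\<Sum>c'\<in>?B. 1 + bit_sign k c * bit_sign k c')"
    using sum_bit_fibre[OF assms, of "\<lambda>_. 1"] by simp
  also have "\<dots> = 2 ^ dim_col L"
    by (simp add: sum.distrib card_bit_vectors sum_bit_sign[OF assms(2)] flip: sum_distrib_left)
  finally have card: "real (card (?B \<inter> ?s)) = 2 ^ dim_col L / 2" by simp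
  have "cond_pmf (uniform_bits (dim_col L)) ?s = pmf_of_set (?B \<inter> ?s)"
    unfolding uniform_bits_eq using ne
    by (intro pmf_eqI) (auto simp: pmf_cond measure_pmf_of_set indicator_def)
  thus ?thesis
    using ne by (simp add: dens_given_bit_def integral_pmf_of_set card sum_bit_fibre[OF assms])
qed

text \<open>Both densities contain the pure-noise density of \<open>y\<close> as a factor, which
  cancels in the ratio.\<close>

lemma log_ratio_eq:
  assumes "0 < N0" "c \<in> bit_vectors (dim_col L)" "k < dim_col L"
  shows "ln (dens_given_bit X L N0 k (c k) h y / dens X L N0 h y) =
    binary_input.log_ratio (bit_vectors (dim_col L)) (bit_sign k) (dim_col X) N0 (\<lambda>c j. h j * symbol X L c $ j) c y"
proof -
  let ?B = "bit_vectors (dim_col L)"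
  interpret binary_input ?B "bit_sign k" "dim_col X" N0 "\<lambda>c j. h j * symbol X L c $ j"
    by (rule binary_input_bits[OF assms(3,1)])
  let ?n = "\<Prod>j<dim_col X. normal_density 0 (sqrt (N0 / 2)) (y j)"
  have "0 < ?n"
    using assms(1) by (intro prod_pos) (auto intro: normal_density_pos)
  have sym: "dens_given_symbol (dim_col X) N0 (symbol X L c) h y = ?n * lik c y" for c
    unfolding dens_given_symbol_eq[OF assms(1)] lik_def ..
  have "dens X L N0 h y = ?n * avg_lik y"
    by (simp add: dens_eq sym avg_lik_def card_bit_vectors flip: sum_distrib_left)
  moreover have "dens_given_bit X L N0 k (c k) h y = ?n * (avg_lik y + bit_sign k c * signed_lik y)"
    by (simp add: dens_given_bit_eq[OF assms(2,3)] sym avg_lik_def signed_lik_def card_bit_vectors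
        algebra_simps sum.distrib sum_distrib_left add_divide_distrib)
  moreover have "n * (a + s * d) / (n * a) = 1 + s * (d / a)" if "0 < n" "0 < a" for n a s d :: real
    using that by (simp add: field_simps)
  from this[OF \<open>0 < ?n\<close> avg_lik_pos] have "?n * (avg_lik y + bit_sign k c * signed_lik y) / (?n * avg_lik y) =
      1 + bit_sign k c * (signed_lik y / avg_lik y)" .
  ultimately have "dens_given_bit X L N0 k (c k) h y / dens X L N0 h y = 1 + bit_sign k c * (signed_lik y / avg_lik y)"
    by simp
  thus ?thesis
    by (simp add: log_ratio_def)
qed

lemma measurable_expectation_dens_given_symbol:
  "(\<lambda>(h, y). measure_pmf.expectation p (\<lambda>c. dens_given_symbol N N0 (symbol X L c) h y))
    \<in> borel_measurable (PiM {..<N} (\<lambda>_. borel) \<Otimes>\<^sub>M PiM {..<N} (\<lambda>_. borel))"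
proof -
  have [measurable]: "(\<lambda>c. symbol X L c $ j) \<in> borel_measurable (measure_pmf p)" for j
    by simp
  show ?thesis
    unfolding dens_given_symbol_def normal_density_def case_prod_beta by measurable
qed

text \<open>The bit value on which the density is conditioned is itself random. For each fixed value
  the map is measurable, and since the values are natural numbers,
  \<open>measurable_compose_countable\<close> glues the countably many cases.\<close>

lemma measurable_log_dens_ratio:
  "(\<lambda>(c, h, z). let y = channel_output (dim_col X) h (symbol X L c) z
      in log 2 (dens_given_bit X L N0 k (c k) h y / dens X L N0 h y))
    \<in> borel_measurable (measure_pmf p \<Otimes>\<^sub>M (PiM {..<dim_col X} (\<lambda>_. borel) \<Otimes>\<^sub>M PiM {..<dim_col X} (\<lambda>_. borel)))"
    (is "_ \<in> borel_measurable ?M")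
proof -
  let ?P = "PiM {..<dim_col X} (\<lambda>_. borel :: real measure)"
  have d [measurable]: "(\<lambda>x. dens_given_bit X L N0 k b (fst x) (snd x)) \<in> borel_measurable (?P \<Otimes>\<^sub>M ?P)" for b
    unfolding dens_given_bit_def using measurable_expectation_dens_given_symbol[unfolded case_prod_beta] by blast
  have d' [measurable]: "(\<lambda>x. dens X L N0 (fst x) (snd x)) \<in> borel_measurable (?P \<Otimes>\<^sub>M ?P)"
    unfolding dens_def using measurable_expectation_dens_given_symbol[unfolded case_prod_beta] by blast
  have r: "(\<lambda>x. log 2 (dens_given_bit X L N0 k b (fst x) (snd x) / dens X L N0 (fst x) (snd x)))
      \<in> borel_measurable (?P \<Otimes>\<^sub>M ?P)" for b
    by measurable
  have [measurable]: "(\<lambda>c. symbol X L c $ j) \<in> borel_measurable (measure_pmf p)" for j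
    by simp
  have out: "(\<lambda>x. (fst (snd x), channel_output (dim_col X) (fst (snd x)) (symbol X L (fst x)) (snd (snd x))))
      \<in> ?M \<rightarrow>\<^sub>M ?P \<Otimes>\<^sub>M ?P"
    unfolding channel_output_def by measurable
  have k: "(\<lambda>x. fst x k) \<in> ?M \<rightarrow>\<^sub>M count_space UNIV"
    by (rule measurable_compose[OF measurable_fst]) simp
  define f where "f b x = log 2 (dens_given_bit X L N0 k b (fst x) (snd x) / dens X L N0 (fst x) (snd x))" for b x
  define g where "g x = (fst (snd x), channel_output (dim_col X) (fst (snd x)) (symbol X L (fst x)) (snd (snd x)))"
    for x :: "(nat \<Rightarrow> nat) \<times> (nat \<Rightarrow> real) \<times> (nat \<Rightarrow> real)"
  have f: "(\<lambda>x. f b (g x)) \<in> borel_measurable ?M" for b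
    using measurable_compose[OF out r] unfolding f_def g_def .
  have "(\<lambda>x. f (fst x k) (g x)) \<in> borel_measurable ?M"
    by (rule measurable_compose_countable[where f = "\<lambda>b x. f b (g x)", OF f k])
  thus ?thesis
    by (simp add: case_prod_beta Let_def f_def g_def)
qed

section \<open>The BICM coefficient\<close>

definition bit_information :: "real mat \<Rightarrow> nat mat \<Rightarrow> real \<Rightarrow> nat \<Rightarrow> (nat \<Rightarrow> real) \<Rightarrow> real" where
  "bit_information X L N0 k h = (\<integral>u. binary_input.info_density (bit_vectors (dim_col L)) (bit_sign k)
     (dim_col X) N0 (\<lambda>c j. h j * symbol X L c $ j) u \<partial>gaussian_noise (dim_col X) N0)"

text \<open>The mean \<open>E[X Q\<^sub>k]\<close> of the symbol weighted by the sign \<open>Q\<^sub>k\<close> of bit \<open>k\<close>; it is row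
  \<open>m - 1 - k\<close> of the only possible \<open>V\<close>.\<close>

definition bit_mean :: "real mat \<Rightarrow> nat mat \<Rightarrow> nat \<Rightarrow> nat \<Rightarrow> real" where
  "bit_mean X L k j = (\<Sum>c\<in>bit_vectors (dim_col L). bit_sign k c * symbol X L c $ j) / 2 ^ dim_col L"

text \<open>Fubini twice. The inner absolute integral over the noise is at most
  \<open>2 * 2 ^ ?m / ln 2\<close> whatever the fading, which suffices on a probability space; over
  the bits integrability is automatic by finite support.\<close>

lemma bit_term_integral:
  assumes N0: "0 < N0" and \<nu>: "prob_space \<nu>" "sets \<nu> = sets (PiM {..<dim_col X} (\<lambda>_. borel))"
    and k: "k < dim_col L"
  shows "(\<integral>(c, h, z). (let y = channel_output (dim_col X) h (symbol X L c) z
      in log 2 (dens_given_bit X L N0 k (c k) h y / dens X L N0 h y))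
      \<partial>channel_law (dim_col L) (dim_col X) \<nu> N0) = (\<integral>h. bit_information X L N0 k h \<partial>\<nu>) / ln 2"
    and "integrable \<nu> (bit_information X L N0 k)"
proof -
  let ?m = "dim_col L" and ?N = "dim_col X"
  let ?B = "bit_vectors ?m" and ?\<gamma> = "gaussian_noise ?N N0"
  define f where "f = (\<lambda>(c, h, z). let y = channel_output ?N h (symbol X L c) z
      in log 2 (dens_given_bit X L N0 k (c k) h y / dens X L N0 h y))"
  interpret \<nu>: prob_space \<nu> by fact
  interpret \<gamma>: prob_space ?\<gamma> by (rule prob_space_gaussian_noise[OF N0])
  interpret p: pair_prob_space \<nu> ?\<gamma> ..
  interpret b: pair_prob_space "measure_pmf (uniform_bits ?m)" "\<nu> \<Otimes>\<^sub>M ?\<gamma>" ..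
  note \<nu>(2) [measurable_cong]
  have f_meas [measurable]: "f \<in> borel_measurable (measure_pmf (uniform_bits ?m) \<Otimes>\<^sub>M (\<nu> \<Otimes>\<^sub>M ?\<gamma>))"
    using measurable_log_dens_ratio[of X L N0 k "uniform_bits ?m"] \<nu>(2) unfolding f_def
    by (simp cong: measurable_cong_sets sets_pair_measure_cong)
  have fc_meas [measurable]: "(\<lambda>x. f (c, x)) \<in> borel_measurable (\<nu> \<Otimes>\<^sub>M ?\<gamma>)" for c
    by (rule measurable_Pair2[OF f_meas]) simp
  let ?lr = "\<lambda>h. binary_input.log_ratio ?B (bit_sign k) ?N N0 (\<lambda>c j. h j * symbol X L c $ j)"
  have f_eq: "f (c, h, z) = ?lr h c (\<lambda>j\<in>{..<?N}. h j * symbol X L c $ j + z j) / ln 2" if "c \<in> ?B" for c h z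
    using log_ratio_eq[OF N0 that k] by (simp add: f_def Let_def log_def channel_output_def)
  have noise: "integrable ?\<gamma> (\<lambda>z. f (c, h, z))" "(\<integral>z. norm (f (c, h, z)) \<partial>?\<gamma>) \<le> 2 * 2 ^ ?m / ln 2"
    if "c \<in> ?B" for c h
  proof -
    interpret binary_input ?B "bit_sign k" ?N N0 "\<lambda>c j. h j * symbol X L c $ j"
      by (rule binary_input_bits[OF k N0])
    show "integrable ?\<gamma> (\<lambda>z. f (c, h, z))"
      using log_ratio_shifted(1)[OF that] by (simp add: f_eq[OF that])
    show "(\<integral>z. norm (f (c, h, z)) \<partial>?\<gamma>) \<le> 2 * 2 ^ ?m / ln 2"
      using log_ratio_shifted(2)[OF that] by (simp add: f_eq[OF that] divide_right_mono card_bit_vectors)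
  qed
  have info: "(\<Sum>c\<in>?B. \<integral>z. f (c, h, z) \<partial>?\<gamma>) / 2 ^ ?m = bit_information X L N0 k h / ln 2" for h
  proof -
    interpret binary_input ?B "bit_sign k" ?N N0 "\<lambda>c j. h j * symbol X L c $ j"
      by (rule binary_input_bits[OF k N0])
    show ?thesis
      unfolding bit_information_def avg_integral_log_ratio[symmetric]
      by (simp add: f_eq card_bit_vectors mult.commute flip: sum_divide_distrib)
  qed
  have fading: "integrable (\<nu> \<Otimes>\<^sub>M ?\<gamma>) (\<lambda>x. f (c, x))" if "c \<in> ?B" for c
  proof (rule p.Fubini_integrable)
    show "integrable \<nu> (\<lambda>h. \<integral>z. norm (f (c, h, z)) \<partial>?\<gamma>)"
    proof (rule \<nu>.integrable_const_bound)
      show "AE h in \<nu>. norm (\<integral>z. norm (f (c, h, z)) \<partial>?\<gamma>) \<le> 2 * 2 ^ ?m / ln 2"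
        using noise(2)[OF that] by (simp add: Bochner_Integration.integral_nonneg)
    qed measurable
  qed (auto intro: noise(1)[OF that])
  have fading': "integrable \<nu> (\<lambda>h. \<integral>z. f (c, h, z) \<partial>?\<gamma>)" if "c \<in> ?B" for c
    using p.integrable_fst'[OF fading[OF that]] .
  have set_bits: "set_pmf (uniform_bits ?m) = ?B"
    by (simp add: uniform_bits_eq)
  have int_f: "integrable (measure_pmf (uniform_bits ?m) \<Otimes>\<^sub>M (\<nu> \<Otimes>\<^sub>M ?\<gamma>)) f"
  proof (rule b.Fubini_integrable)
    show "integrable (measure_pmf (uniform_bits ?m)) (\<lambda>c. \<integral>x. norm (f (c, x)) \<partial>(\<nu> \<Otimes>\<^sub>M ?\<gamma>))"
      by (rule integrable_measure_pmf_finite) (simp add: set_bits)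
    show "AE c in measure_pmf (uniform_bits ?m). integrable (\<nu> \<Otimes>\<^sub>M ?\<gamma>) (\<lambda>x. f (c, x))"
      using fading by (auto simp: AE_measure_pmf_iff set_bits)
  qed simp
  have "integrable \<nu> (\<lambda>h. ln 2 * ((\<Sum>c\<in>?B. \<integral>z. f (c, h, z) \<partial>?\<gamma>) / 2 ^ ?m))"
    by (intro integrable_mult_right integrable_divide Bochner_Integration.integrable_sum fading')
  thus "integrable \<nu> (bit_information X L N0 k)"
    by (simp add: info)
  have "(\<integral>x. f x \<partial>channel_law ?m ?N \<nu> N0) =
      (\<integral>c. (\<integral>x. f (c, x) \<partial>(\<nu> \<Otimes>\<^sub>M ?\<gamma>)) \<partial>measure_pmf (uniform_bits ?m))"
    unfolding channel_law_def by (rule b.integral_fst'[OF int_f, symmetric])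
  also have "\<dots> = (\<Sum>c\<in>?B. \<integral>x. f (c, x) \<partial>(\<nu> \<Otimes>\<^sub>M ?\<gamma>)) / 2 ^ ?m"
    by (simp add: uniform_bits_eq integral_pmf_of_set card_bit_vectors)
  also have "\<dots> = (\<Sum>c\<in>?B. \<integral>h. (\<integral>z. f (c, h, z) \<partial>?\<gamma>) \<partial>\<nu>) / 2 ^ ?m"
    using p.integral_fst'[OF fading] by simp
  also have "\<dots> = (\<integral>h. (\<Sum>c\<in>?B. \<integral>z. f (c, h, z) \<partial>?\<gamma>) / 2 ^ ?m \<partial>\<nu>)"
    using fading' by (simp add: Bochner_Integration.integral_sum)
  also have "\<dots> = (\<integral>h. bit_information X L N0 k h \<partial>\<nu>) / ln 2"
    unfolding info by simp
  finally show "(\<integral>(c, h, z). (let y = channel_output (dim_col X) h (symbol X L c) z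
      in log 2 (dens_given_bit X L N0 k (c k) h y / dens X L N0 h y))
      \<partial>channel_law (dim_col L) (dim_col X) \<nu> N0) = (\<integral>h. bit_information X L N0 k h \<partial>\<nu>) / ln 2"
    unfolding f_def .
qed

text \<open>A simple majorant of every squared symbol coordinate.\<close>

definition symbol_bound :: "real mat \<Rightarrow> nat mat \<Rightarrow> real" where
  "symbol_bound X L = (\<Sum>c\<in>bit_vectors (dim_col L). \<Sum>j<dim_col X. (symbol X L c $ j)\<^sup>2)"

lemma bit_information_expansion:
  assumes N0: "0 < N0" and k: "k < dim_col L"
  shows "\<bar>bit_information X L N0 k h - (\<Sum>j<dim_col X. (bit_mean X L k j)\<^sup>2 * (h j)\<^sup>2) / N0\<bar> \<le>
    (17 * 24 * exp 8 * (2 * exp 32) ^ dim_col X + 6 * exp 3) * (2 * symbol_bound X L)\<^sup>2 *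
    (\<Sum>j<dim_col X. (h j)\<^sup>2)\<^sup>2 / N0\<^sup>2"
proof -
  let ?N = "dim_col X" and ?B = "bit_vectors (dim_col L)"
  interpret binary_input ?B "bit_sign k" ?N N0 "\<lambda>c j. h j * symbol X L c $ j"
    by (rule binary_input_bits[OF k N0])
  define H where "H = (\<Sum>j<?N. (h j)\<^sup>2)"
  define b where "b = symbol_bound X L"
  have "0 \<le> H" "0 \<le> b"
    by (auto simp: H_def b_def symbol_bound_def intro!: sum_nonneg)
  \<comment> \<open>The amplitude for which \<open>N0 * t^2 / 2\<close> equals \<open>b * H\<close>,
    an upper bound of the energy of every faded symbol.\<close>
  define t where "t = sqrt (2 * b * H / N0)"
  have "0 \<le> 2 * b * H / N0"
    using \<open>0 \<le> H\<close> \<open>0 \<le> b\<close> N0 by simp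
  hence t: "0 \<le> t" "t\<^sup>2 = 2 * b * H / N0"
    by (auto simp: t_def)
  have "t ^ 4 = (t\<^sup>2)\<^sup>2" by simp
  also have "\<dots> = (2 * b)\<^sup>2 * H\<^sup>2 / N0\<^sup>2"
    unfolding t(2) by (simp add: power_mult_distrib power_divide)
  finally have t4: "t ^ 4 = (2 * b)\<^sup>2 * H\<^sup>2 / N0\<^sup>2" .
  have w: "(\<Sum>j<?N. (h j * symbol X L c $ j)\<^sup>2) \<le> N0 * t\<^sup>2 / 2" if "c \<in> ?B" for c
  proof -
    have "(symbol X L c $ j)\<^sup>2 \<le> b" if "j < ?N" for j
    proof -
      have "(symbol X L c $ j)\<^sup>2 \<le> (\<Sum>j<?N. (symbol X L c $ j)\<^sup>2)"
        using that by (intro member_le_sum) auto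
      also have "\<dots> \<le> b"
        unfolding b_def symbol_bound_def using \<open>c \<in> ?B\<close>
        by (intro member_le_sum[where f = "\<lambda>c. \<Sum>j<?N. (symbol X L c $ j)\<^sup>2"]) (auto intro: sum_nonneg)
      finally show ?thesis .
    qed
    hence "(h j * symbol X L c $ j)\<^sup>2 \<le> b * (h j)\<^sup>2" if "j < ?N" for j
      using mult_left_mono[of "(symbol X L c $ j)\<^sup>2" b "(h j)\<^sup>2"] that
      by (simp add: power_mult_distrib mult.commute)
    hence "(\<Sum>j<?N. (h j * symbol X L c $ j)\<^sup>2) \<le> (\<Sum>j<?N. b * (h j)\<^sup>2)"
      by (intro sum_mono) simp
    also have "\<dots> = b * H"
      by (simp add: H_def sum_distrib_left)
    also have "\<dots> = N0 * t\<^sup>2 / 2"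
      unfolding t(2) using N0 by simp
    finally show ?thesis .
  qed
  have "mean_shift j = h j * bit_mean X L k j" for j
    by (simp add: mean_shift_def bit_mean_def card_bit_vectors sum_distrib_left mult_ac)
  hence "(mean_shift j)\<^sup>2 = (bit_mean X L k j)\<^sup>2 * (h j)\<^sup>2" for j
    by (simp add: power_mult_distrib)
  thus ?thesis
    using integral_info_density_expansion[OF t(1) w]
    by (simp add: t4 bit_information_def mult.assoc flip: H_def b_def)
qed

text \<open>The main term is a weighted sum of the squares of the \<open>h j\<close>, so the common
  marginal law fixes its mean whatever the dependence between components. The error involves the
  joint fourth moment, supplied by the tail condition.\<close>

lemma bicm_information_expansion:
  assumes "fading_law (dim_col X) \<nu> \<eta>"
  obtains C where "\<And>N0. 0 < N0 \<Longrightarrow>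
    \<bar>bicm_information X L \<nu> N0 -
      (\<Sum>k<dim_col L. \<Sum>j<dim_col X. (bit_mean X L k j)\<^sup>2) * (\<integral>x. x\<^sup>2 \<partial>\<eta>) / (N0 * ln 2)\<bar> \<le> C / N0\<^sup>2"
proof -
  let ?m = "dim_col L" and ?N = "dim_col X"
  have \<nu>: "prob_space \<nu>" "sets \<nu> = sets (PiM {..<?N} (\<lambda>_. borel))"
    and marg: "\<And>j. j < ?N \<Longrightarrow> distr \<nu> borel (\<lambda>h. h j) = \<eta>"
    and \<eta>: "integrable \<eta> (\<lambda>x. x\<^sup>2)"
    using assms by (auto simp: fading_law_def)
  obtain \<omega> where tail: "0 < \<omega>" "\<forall>\<^sub>F \<Delta> in at_top.
        measure \<nu> {h \<in> space \<nu>. (\<Sum>j<?N. (h j)\<^sup>2) > \<Delta>} \<le> exp (- (\<Delta> powr \<omega>))"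
    using assms by (auto simp: fading_law_def)
  note \<nu>(2) [measurable_cong]
  have H4: "integrable \<nu> (\<lambda>h. (\<Sum>j<?N. (h j)\<^sup>2)\<^sup>2)"
    by (rule integrable_square_of_exponential_tail[OF \<nu>(1) _ _ tail]) (auto intro: sum_nonneg)
  have [measurable]: "(\<lambda>h. h j) \<in> borel_measurable \<nu>" if "j < ?N" for j
    unfolding measurable_cong_sets[OF \<nu>(2) refl] using that by (intro measurable_component_singleton) simp
  have H2: "integrable \<nu> (\<lambda>h. (h j)\<^sup>2)" "(\<integral>h. (h j)\<^sup>2 \<partial>\<nu>) = (\<integral>x. x\<^sup>2 \<partial>\<eta>)" if "j < ?N" for j
  proof -
    show "integrable \<nu> (\<lambda>h. (h j)\<^sup>2)"
      using \<eta> that unfolding marg[OF that, symmetric] by (subst (asm) integrable_distr_eq) auto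
    show "(\<integral>h. (h j)\<^sup>2 \<partial>\<nu>) = (\<integral>x. x\<^sup>2 \<partial>\<eta>)"
      using that unfolding marg[OF that, symmetric] by (subst integral_distr) auto
  qed
  define K where "K = (17 * 24 * exp 8 * (2 * exp 32) ^ ?N + 6 * exp 3) * (2 * symbol_bound X L)\<^sup>2"
  define Q where "Q = (\<integral>h. (\<Sum>j<?N. (h j)\<^sup>2)\<^sup>2 \<partial>\<nu>)"
  have "\<bar>bicm_information X L \<nu> N0 -
      (\<Sum>k<?m. \<Sum>j<?N. (bit_mean X L k j)\<^sup>2) * (\<integral>x. x\<^sup>2 \<partial>\<eta>) / (N0 * ln 2)\<bar> \<le> (?m * (K * Q) / ln 2) / N0\<^sup>2"
    if N0: "0 < N0" for N0
  proof -
    have bit: "\<bar>(\<integral>h. bit_information X L N0 k h \<partial>\<nu>) - (\<Sum>j<?N. (bit_mean X L k j)\<^sup>2) * (\<integral>x. x\<^sup>2 \<partial>\<eta>) / N0\<bar>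
        \<le> K * Q / N0\<^sup>2" if k: "k < ?m" for k
    proof -
      let ?q = "\<lambda>h. (\<Sum>j<?N. (bit_mean X L k j)\<^sup>2 * (h j)\<^sup>2) / N0"
      note int = bit_term_integral(2)[OF N0 \<nu> k]
      have q: "integrable \<nu> ?q"
        by (intro integrable_divide Bochner_Integration.integrable_sum integrable_mult_right H2) auto
      have q_eq: "(\<integral>h. ?q h \<partial>\<nu>) = (\<Sum>j<?N. (bit_mean X L k j)\<^sup>2) * (\<integral>x. x\<^sup>2 \<partial>\<eta>) / N0"
        by (simp add: Bochner_Integration.integral_sum H2 sum_distrib_right)
      have "\<bar>(\<integral>h. bit_information X L N0 k h \<partial>\<nu>) - (\<Sum>j<?N. (bit_mean X L k j)\<^sup>2) * (\<integral>x. x\<^sup>2 \<partial>\<eta>) / N0\<bar> =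
          \<bar>\<integral>h. bit_information X L N0 k h - ?q h \<partial>\<nu>\<bar>"
        unfolding q_eq[symmetric] Bochner_Integration.integral_diff[OF int q] ..
      also have "\<dots> \<le> (\<integral>h. \<bar>bit_information X L N0 k h - ?q h\<bar> \<partial>\<nu>)"
        by (rule integral_abs_bound)
      also have "\<dots> \<le> (\<integral>h. K * (\<Sum>j<?N. (h j)\<^sup>2)\<^sup>2 / N0\<^sup>2 \<partial>\<nu>)"
        using bit_information_expansion[OF N0 k, of X]
        by (intro integral_mono integrable_abs Bochner_Integration.integrable_diff int q
            integrable_divide integrable_mult_right H4) (simp add: K_def)
      also have "\<dots> = K * Q / N0\<^sup>2"
        by (simp add: Q_def)
      finally show ?thesis .
    qed
    have "bicm_information X L \<nu> N0 = (\<Sum>k<?m. \<integral>h. bit_information X L N0 k h \<partial>\<nu>) / ln 2"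
      unfolding bicm_information_def sum_divide_distrib
      by (intro sum.cong refl bit_term_integral(1)[OF N0 \<nu>]) simp
    hence "bicm_information X L \<nu> N0 -
        (\<Sum>k<?m. \<Sum>j<?N. (bit_mean X L k j)\<^sup>2) * (\<integral>x. x\<^sup>2 \<partial>\<eta>) / (N0 * ln 2) =
        (\<Sum>k<?m. (\<integral>h. bit_information X L N0 k h \<partial>\<nu>) - (\<Sum>j<?N. (bit_mean X L k j)\<^sup>2) * (\<integral>x. x\<^sup>2 \<partial>\<eta>) / N0) / ln 2"
      by (simp add: sum_subtractf diff_divide_distrib flip: sum_distrib_right sum_divide_distrib)
    hence "\<bar>bicm_information X L \<nu> N0 -
        (\<Sum>k<?m. \<Sum>j<?N. (bit_mean X L k j)\<^sup>2) * (\<integral>x. x\<^sup>2 \<partial>\<eta>) / (N0 * ln 2)\<bar> =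
        \<bar>\<Sum>k<?m. (\<integral>h. bit_information X L N0 k h \<partial>\<nu>) - (\<Sum>j<?N. (bit_mean X L k j)\<^sup>2) * (\<integral>x. x\<^sup>2 \<partial>\<eta>) / N0\<bar> / ln 2"
      by (simp only: abs_divide) simp
    also have "\<dots> \<le> (\<Sum>k<?m. K * Q / N0\<^sup>2) / ln 2"
      by (intro divide_right_mono order.trans[OF sum_abs] sum_mono bit) auto
    finally show ?thesis by (simp add: mult_ac)
  qed
  thus ?thesis by (rule that)
qed

text \<open>Bessel's inequality as an identity: its defect is the squared distance from
  \<open>f\<close> to the span of the signs, so the case of equality can be read off. Each sign has
  squared norm \<open>2 ^ m\<close>.\<close>

lemma bit_sign_residual:
  fixes f :: "(nat \<Rightarrow> nat) \<Rightarrow> real" and m :: nat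
  defines "a \<equiv> \<lambda>k. (\<Sum>c\<in>bit_vectors m. bit_sign k c * f c) / 2 ^ m"
  shows "(\<Sum>c\<in>bit_vectors m. (f c - (\<Sum>k<m. bit_sign k c * a k))\<^sup>2) =
    (\<Sum>c\<in>bit_vectors m. (f c)\<^sup>2) - 2 ^ m * (\<Sum>k<m. (a k)\<^sup>2)"
proof -
  let ?B = "bit_vectors m"
  define g where "g c = (\<Sum>k<m. bit_sign k c * a k)" for c
  have coeff: "(\<Sum>c\<in>?B. bit_sign k c * f c) = 2 ^ m * a k" for k
    by (simp add: a_def)
  have "(\<Sum>c\<in>?B. f c * g c) = (\<Sum>c\<in>?B. \<Sum>k<m. a k * (bit_sign k c * f c))"
    by (simp add: g_def sum_distrib_left mult_ac)
  also have "\<dots> = (\<Sum>k<m. a k * (\<Sum>c\<in>?B. bit_sign k c * f c))"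
    by (subst sum.swap) (simp add: sum_distrib_left)
  also have "\<dots> = 2 ^ m * (\<Sum>k<m. (a k)\<^sup>2)"
    unfolding coeff by (simp add: sum_distrib_left power2_eq_square mult_ac)
  finally have fg: "(\<Sum>c\<in>?B. f c * g c) = 2 ^ m * (\<Sum>k<m. (a k)\<^sup>2)" .
  \<comment> \<open>The projection \<open>g\<close> has the same coefficients as \<open>f\<close>,
    hence the inner product of \<open>g\<close> with itself equals that of \<open>f\<close> with
    \<open>g\<close>.\<close>
  have gcoeff: "(\<Sum>c\<in>?B. bit_sign k c * g c) = 2 ^ m * a k" if "k < m" for k
  proof -
    have "(\<Sum>c\<in>?B. bit_sign k c * g c) = (\<Sum>c\<in>?B. \<Sum>l<m. a l * (bit_sign k c * bit_sign l c))"
      by (simp add: g_def sum_distrib_left mult_ac)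
    also have "\<dots> = (\<Sum>l<m. a l * (\<Sum>c\<in>?B. bit_sign k c * bit_sign l c))"
      by (subst sum.swap) (simp add: sum_distrib_left)
    also have "\<dots> = (\<Sum>l<m. if k = l then 2 ^ m * a l else 0)"
      using that by (intro sum.cong refl) (simp add: sum_bit_sign_orthogonal)
    finally show ?thesis using that by simp
  qed
  have "(\<Sum>c\<in>?B. g c * g c) = (\<Sum>c\<in>?B. \<Sum>k<m. a k * (bit_sign k c * g c))"
    by (subst (2) g_def) (simp add: sum_distrib_left mult_ac)
  also have "\<dots> = (\<Sum>k<m. a k * (\<Sum>c\<in>?B. bit_sign k c * g c))"
    by (subst sum.swap) (simp add: sum_distrib_left)
  also have "\<dots> = (\<Sum>k<m. a k * (2 ^ m * a k))"
    by (intro sum.cong refl) (simp add: gcoeff)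
  also have "\<dots> = 2 ^ m * (\<Sum>k<m. (a k)\<^sup>2)"
    by (simp add: sum_distrib_left power2_eq_square mult_ac)
  finally have gg: "(\<Sum>c\<in>?B. g c * g c) = 2 ^ m * (\<Sum>k<m. (a k)\<^sup>2)" .
  have "(\<Sum>c\<in>?B. (f c - g c)\<^sup>2) = (\<Sum>c\<in>?B. (f c)\<^sup>2 - 2 * (f c * g c) + g c * g c)"
    by (simp add: power2_eq_square algebra_simps)
  also have "\<dots> = (\<Sum>c\<in>?B. (f c)\<^sup>2) - 2 * (\<Sum>c\<in>?B. f c * g c) + (\<Sum>c\<in>?B. g c * g c)"
    by (simp add: sum.distrib sum_subtractf sum_distrib_left)
  also have "\<dots> = (\<Sum>c\<in>?B. (f c)\<^sup>2) - 2 ^ m * (\<Sum>k<m. (a k)\<^sup>2)"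
    unfolding fg gg by simp
  finally show ?thesis
    unfolding g_def .
qed

lemma symbol_energy_eq:
  "symbol_energy X L = (\<Sum>c\<in>bit_vectors (dim_col L). \<Sum>j<dim_col X. (symbol X L c $ j)\<^sup>2) / 2 ^ dim_col L"
  by (simp add: symbol_energy_def uniform_bits_eq integral_pmf_of_set card_bit_vectors)

lemma energy_eq_sum_bit_mean_iff:
  "symbol_energy X L = (\<Sum>k<dim_col L. \<Sum>j<dim_col X. (bit_mean X L k j)\<^sup>2) \<longleftrightarrow>
    (\<forall>c\<in>bit_vectors (dim_col L). \<forall>j<dim_col X.
      symbol X L c $ j = (\<Sum>k<dim_col L. bit_sign k c * bit_mean X L k j))"
proof -
  let ?m = "dim_col L" and ?N = "dim_col X" and ?B = "bit_vectors (dim_col L)"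
  let ?r = "\<lambda>c j. symbol X L c $ j - (\<Sum>k<?m. bit_sign k c * bit_mean X L k j)"
  have "(\<Sum>j<?N. \<Sum>c\<in>?B. (?r c j)\<^sup>2) =
      (\<Sum>j<?N. (\<Sum>c\<in>?B. (symbol X L c $ j)\<^sup>2) - 2 ^ ?m * (\<Sum>k<?m. (bit_mean X L k j)\<^sup>2))"
    unfolding bit_mean_def by (intro sum.cong refl bit_sign_residual)
  also have "\<dots> = 2 ^ ?m * symbol_energy X L - 2 ^ ?m * (\<Sum>k<?m. \<Sum>j<?N. (bit_mean X L k j)\<^sup>2)"
    by (simp add: sum_subtractf symbol_energy_eq sum.swap[of _ ?B] sum.swap[of _ "{..<?m}"] flip: sum_distrib_left)
  finally have "symbol_energy X L = (\<Sum>k<?m. \<Sum>j<?N. (bit_mean X L k j)\<^sup>2) \<longleftrightarrow>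
      (\<Sum>j<?N. \<Sum>c\<in>?B. (?r c j)\<^sup>2) = 0"
    by simp
  also have "\<dots> \<longleftrightarrow> (\<forall>j<?N. \<forall>c\<in>?B. ?r c j = 0)"
    by (subst sum_nonneg_eq_0_iff) (auto simp: sum_nonneg_eq_0_iff intro: sum_nonneg)
  finally show ?thesis by auto
qed

lemma bit_mean_of_combination:
  assumes "\<And>c. c \<in> bit_vectors (dim_col L) \<Longrightarrow> symbol X L c $ j = (\<Sum>k<dim_col L. bit_sign k c * v k)"
    and "k < dim_col L"
  shows "bit_mean X L k j = v k"
proof -
  let ?m = "dim_col L"
  have "(\<Sum>c\<in>bit_vectors ?m. bit_sign k c * symbol X L c $ j) =
      (\<Sum>c\<in>bit_vectors ?m. \<Sum>l<?m. v l * (bit_sign k c * bit_sign l c))"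
    by (simp add: assms(1) sum_distrib_left mult_ac)
  also have "\<dots> = (\<Sum>l<?m. v l * (\<Sum>c\<in>bit_vectors ?m. bit_sign k c * bit_sign l c))"
    by (subst sum.swap) (simp add: sum_distrib_left)
  also have "\<dots> = (\<Sum>l<?m. if k = l then 2 ^ ?m * v l else 0)"
    using assms(2) by (intro sum.cong refl) (simp add: sum_bit_sign_orthogonal)
  finally show ?thesis
    using assms(2) by (simp add: bit_mean_def)
qed

section \<open>Bit vectors, row indices and the matrix factorization\<close>

lemma symbol_of_label:
  assumes "binary_labeling m L" "i < 2 ^ m" "c \<in> bit_vectors m" "\<And>k. k < m \<Longrightarrow> L $$ (i, k) = c k"
  shows "symbol X L c = row X i"
proof -
  have L: "L \<in> carrier_mat (2 ^ m) m" "inj_on (row L) {..<2 ^ m}"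
    using assms(1) by (auto simp: binary_labeling_def bij_betw_def)
  have "vec m c = row L i"
    using L(1) assms(2,4) by (intro eq_vecI) auto
  thus ?thesis
    using L assms(2) by (simp add: symbol_def inv_into_f_f)
qed

lemma label_exists:
  assumes "binary_labeling m L" "i < 2 ^ m"
  shows "\<exists>c\<in>bit_vectors m. \<forall>k<m. L $$ (i, k) = c k"
proof -
  have L: "L \<in> carrier_mat (2 ^ m) m" "row L ` {..<2 ^ m} = {c \<in> carrier_vec m. \<forall>k<m. c $ k \<in> {0, 1}}"
    using assms(1) by (auto simp: binary_labeling_def bij_betw_def)
  have "row L i \<in> row L ` {..<2 ^ m}"
    using assms(2) by simp
  hence "row L i $ k \<in> {0, 1}" if "k < m" for k
    using that unfolding L(2) by simp
  hence "L $$ (i, k) \<in> {0, 1}" if "k < m" for k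
    using that L(1) assms(2) by fastforce
  thus ?thesis
    \<comment> \<open>Extended by 0 beyond \<open>m\<close>, the dummy value of
      \<open>uniform_bits\<close>.\<close>
    by (intro bexI[of _ "\<lambda>k. if k < m then L $$ (i, k) else 0"]) (auto simp: bit_vectors_def PiE_dflt_def)
qed

lemma index_exists:
  assumes "binary_labeling m L" "c \<in> bit_vectors m"
  shows "\<exists>i<2 ^ m. \<forall>k<m. L $$ (i, k) = c k"
proof -
  have L: "L \<in> carrier_mat (2 ^ m) m" "row L ` {..<2 ^ m} = {c \<in> carrier_vec m. \<forall>k<m. c $ k \<in> {0, 1}}"
    using assms(1) by (auto simp: binary_labeling_def bij_betw_def)
  have "vec m c \<in> row L ` {..<2 ^ m}"
    unfolding L(2) using bit_vectors_cases[OF assms(2)] by auto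
  then obtain i where i: "i < 2 ^ m" "vec m c = row L i" by auto
  have "L $$ (i, k) = c k" if "k < m" for k
    using arg_cong[OF i(2), of "\<lambda>v. v $ k"] that L(1) i(1) by simp
  thus ?thesis using i(1) by blast
qed

lemma modified_labeling_mult_index:
  assumes "L \<in> carrier_mat (2 ^ m) m" "V \<in> carrier_mat m N" "i < 2 ^ m" "j < N"
    and "\<And>k. k < m \<Longrightarrow> L $$ (i, k) = c k"
  shows "(modified_labeling L * V) $$ (i, j) = (\<Sum>k<m. bit_sign k c * V $$ (m - 1 - k, j))"
proof -
  have "(modified_labeling L * V) $$ (i, j) = (\<Sum>k<m. bit_sign (m - Suc k) c * V $$ (k, j))"
    using assms by (auto simp: modified_labeling_def scalar_prod_def atLeast0LessThan bit_sign_def intro!: sum.cong)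
  \<comment> \<open>Writing \<open>k\<close> as its double reversal turns the whole summand into a
    function of \<open>m - Suc k\<close>, so that the sum can be reflected: bit \<open>k\<close>
    meets row \<open>m - 1 - k\<close> of \<open>V\<close>.\<close>
  also have "\<dots> = (\<Sum>k<m. bit_sign (m - Suc k) c * V $$ (m - 1 - (m - Suc k), j))"
    by (intro sum.cong) auto
  also have "\<dots> = (\<Sum>k<m. bit_sign k c * V $$ (m - 1 - k, j))"
    by (rule sum.nat_diff_reindex)
  finally show ?thesis .
qed

text \<open>Orthogonality of the signs leaves one candidate for \<open>V\<close>, built from the bit
  means, so existence becomes a condition on the symbols alone.\<close>

lemma factorization_iff:
  assumes X: "X \<in> carrier_mat (2 ^ m) N" and L: "binary_labeling m L"
  shows "(\<exists>V\<in>carrier_mat m N. X = modified_labeling L * V) \<longleftrightarrow>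
    (\<forall>c\<in>bit_vectors m. \<forall>j<N. symbol X L c $ j = (\<Sum>k<m. bit_sign k c * bit_mean X L k j))"
proof
  have Lm: "L \<in> carrier_mat (2 ^ m) m"
    using L by (simp add: binary_labeling_def)
  hence dim: "dim_col L = m" by simp
  {
    assume "\<exists>V\<in>carrier_mat m N. X = modified_labeling L * V"
    then obtain V where V: "V \<in> carrier_mat m N" "X = modified_labeling L * V" by blast
    have comb: "symbol X L c $ j = (\<Sum>k<m. bit_sign k c * V $$ (m - 1 - k, j))"
      if "c \<in> bit_vectors m" "j < N" for c j
    proof -
      obtain i where i: "i < 2 ^ m" "\<And>k. k < m \<Longrightarrow> L $$ (i, k) = c k"
        using index_exists[OF L \<open>c \<in> bit_vectors m\<close>] by blast
      have "symbol X L c $ j = X $$ (i, j)"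
        using symbol_of_label[OF L i(1) that(1) i(2)] X i(1) that(2) by simp
      thus ?thesis
        using modified_labeling_mult_index[OF Lm V(1) i(1) that(2) i(2)] V(2) by simp
    qed
    show "\<forall>c\<in>bit_vectors m. \<forall>j<N. symbol X L c $ j = (\<Sum>k<m. bit_sign k c * bit_mean X L k j)"
    proof (intro ballI allI impI)
      fix c j assume c: "c \<in> bit_vectors m" and j: "j < N"
      have "bit_mean X L k j = V $$ (m - 1 - k, j)" if "k < m" for k
        using that comb j by (intro bit_mean_of_combination) (auto simp: dim)
      thus "symbol X L c $ j = (\<Sum>k<m. bit_sign k c * bit_mean X L k j)"
        using comb[OF c j] by simp
    qed
  }
  {
    assume comb: "\<forall>c\<in>bit_vectors m. \<forall>j<N. symbol X L c $ j = (\<Sum>k<m. bit_sign k c * bit_mean X L k j)"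
    define V where "V = mat m N (\<lambda>(k, j). bit_mean X L (m - 1 - k) j)"
    have V: "V \<in> carrier_mat m N" by (simp add: V_def)
    have "X = modified_labeling L * V"
    proof (rule eq_matI)
      fix i j assume "i < dim_row (modified_labeling L * V)" "j < dim_col (modified_labeling L * V)"
      hence i: "i < 2 ^ m" and j: "j < N"
        using Lm V by (auto simp: modified_labeling_def)
      obtain c where c: "c \<in> bit_vectors m" "\<And>k. k < m \<Longrightarrow> L $$ (i, k) = c k"
        using label_exists[OF L i] by blast
      have "X $$ (i, j) = symbol X L c $ j"
        using symbol_of_label[OF L i c] X i j by simp
      also have "\<dots> = (\<Sum>k<m. bit_sign k c * V $$ (m - 1 - k, j))"
        using comb c(1) j by (auto simp: V_def intro!: sum.cong)
      also have "\<dots> = (modified_labeling L * V) $$ (i, j)"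
        by (rule modified_labeling_mult_index[OF Lm V i j c(2), symmetric])
      finally show "X $$ (i, j) = (modified_labeling L * V) $$ (i, j)" .
    qed (use X Lm V in \<open>auto simp: modified_labeling_def\<close>)
    thus "\<exists>V\<in>carrier_mat m N. X = modified_labeling L * V"
      using V by blast
  }
qed

text \<open>Zero energy would make every row zero, but for \<open>m \<ge> 1\<close> there are at
  least two rows and they are distinct. Positivity makes the passage between SNR and noise level
  meaningful.\<close>

lemma symbol_energy_pos:
  assumes "1 \<le> m" and X: "input_alphabet m N X" and L: "binary_labeling m L"
  shows "0 < symbol_energy X L"
proof (rule ccontr)
  have dims: "X \<in> carrier_mat (2 ^ m) N" "dim_col L = m" "dim_col X = N"
    using X L by (auto simp: input_alphabet_def binary_labeling_def)
  assume "\<not> 0 < symbol_energy X L"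
  hence "(\<Sum>c\<in>bit_vectors m. \<Sum>j<N. (symbol X L c $ j)\<^sup>2) \<le> 0"
    by (simp add: symbol_energy_eq dims zero_less_divide_iff)
  hence "(\<Sum>c\<in>bit_vectors m. \<Sum>j<N. (symbol X L c $ j)\<^sup>2) = 0"
    by (intro antisym sum_nonneg) auto
  hence zero: "symbol X L c $ j = 0" if "c \<in> bit_vectors m" "j < N" for c j
    using that by (simp add: sum_nonneg_eq_0_iff sum_nonneg)
  have "row X i = 0\<^sub>v N" if i: "i < 2 ^ m" for i
  proof -
    obtain c where c: "c \<in> bit_vectors m" "\<And>k. k < m \<Longrightarrow> L $$ (i, k) = c k"
      using label_exists[OF L i] by blast
    show ?thesis
      using symbol_of_label[OF L i c, of X] zero[OF c(1)] dims i by (intro eq_vecI) auto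
  qed
  moreover have "(0::nat) < 2 ^ m" "(1::nat) < 2 ^ m"
    using assms(1) one_less_power[of "2::nat" m] by auto
  ultimately have "rows X ! 0 = rows X ! 1"
    using dims(1) by (simp add: nth_rows)
  moreover have "distinct (rows X)" "length (rows X) = 2 ^ m"
    using X by (auto simp: input_alphabet_def)
  ultimately show False
    using \<open>(1::nat) < 2 ^ m\<close> nth_eq_iff_index_eq[of "rows X" 0 1] by simp
qed

lemma bicm_coefficient_eq:
  assumes fad: "fading_law (dim_col X) \<nu> \<eta>" and E: "0 < symbol_energy X L"
  shows "bicm_coefficient X L \<nu> \<eta> =
    (\<Sum>k<dim_col L. \<Sum>j<dim_col X. (bit_mean X L k j)\<^sup>2) / (symbol_energy X L * ln 2)"
proof (rule bicm_coefficient_eqI)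
  define A where "A = (\<Sum>k<dim_col L. \<Sum>j<dim_col X. (bit_mean X L k j)\<^sup>2)"
  define s where "s = (\<integral>x. x\<^sup>2 \<partial>\<eta>)"
  \<comment> \<open>The numerator of the SNR, so that the noise level is \<open>P / snr\<close>; the
    second moment \<open>s\<close> cancels from the linear coefficient.\<close>
  define P where "P = s * symbol_energy X L"
  have "0 < s" using fad by (simp add: fading_law_def s_def)
  hence "0 < P" using E by (simp add: P_def)
  obtain C where C: "\<And>N0. 0 < N0 \<Longrightarrow> \<bar>bicm_information X L \<nu> N0 - A * s / (N0 * ln 2)\<bar> \<le> C / N0\<^sup>2"
    using bicm_information_expansion[OF fad, of L] unfolding A_def s_def by blast
  show "bicm_first_order X L \<nu> \<eta> (A / (symbol_energy X L * ln 2))"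
    unfolding bicm_first_order_def
  proof (rule bigoI[where c = "C / P\<^sup>2"])
    show "\<forall>\<^sub>F snr in at_right 0. norm (bicm_capacity X L \<nu> \<eta> snr - A / (symbol_energy X L * ln 2) * snr)
        \<le> C / P\<^sup>2 * norm (snr\<^sup>2)"
      using eventually_at_right_less[of "0::real"]
    proof eventually_elim
      case (elim snr)
      have "bicm_capacity X L \<nu> \<eta> snr = bicm_information X L \<nu> (P / snr)"
        by (simp add: bicm_capacity_def P_def s_def)
      moreover have "A * s / (P / snr * ln 2) = A / (symbol_energy X L * ln 2) * snr"
        using \<open>0 < s\<close> E by (simp add: P_def)
      moreover have "C / (P / snr)\<^sup>2 = C / P\<^sup>2 * norm (snr\<^sup>2)"
        by (simp add: power_divide)
      ultimately show ?case
        using C[of "P / snr"] elim \<open>0 < P\<close> by simp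
    qed
  qed
qed

theorem theorem12:
  fixes m N :: nat and X :: "real mat" and L :: "nat mat"
    and \<nu> :: "(nat \<Rightarrow> real) measure" and \<eta> :: "real measure"
  assumes "1 \<le> m" and "1 \<le> N"
    and "input_alphabet m N X" and "binary_labeling m L"
    and "fading_law N \<nu> \<eta>"
  shows "first_order_optimal X L \<nu> \<eta> \<longleftrightarrow>
    (\<exists>V \<in> carrier_mat m N. X = modified_labeling L * V)"
proof -
  have dims: "X \<in> carrier_mat (2 ^ m) N" "dim_col L = m" "dim_col X = N"
    using assms(3,4) by (auto simp: input_alphabet_def binary_labeling_def)
  have E: "0 < symbol_energy X L"
    by (rule symbol_energy_pos[OF assms(1,3,4)])
  \<comment> \<open>As log2(e) = 1 / ln 2, the logarithms cancel and what remains is the equality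
    case of Bessel's inequality.\<close>
  have "first_order_optimal X L \<nu> \<eta> \<longleftrightarrow>
      (\<Sum>k<m. \<Sum>j<N. (bit_mean X L k j)\<^sup>2) / (symbol_energy X L * ln 2) = 1 / ln 2"
    using bicm_coefficient_eq[of X \<nu> \<eta> L] assms(5) E
    by (simp add: first_order_optimal_def dims log_def)
  also have "\<dots> \<longleftrightarrow> symbol_energy X L = (\<Sum>k<m. \<Sum>j<N. (bit_mean X L k j)\<^sup>2)"
    using E by (auto simp: field_simps)
  also have "\<dots> \<longleftrightarrow> (\<exists>V \<in> carrier_mat m N. X = modified_labeling L * V)"
    unfolding factorization_iff[OF dims(1) assms(4)]
    using energy_eq_sum_bit_mean_iff[of X L] by (simp add: dims)
  finally show ?thesis .
qed

end
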